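(* If $L$ is a non-scattered nonempty linear order, then $\mathrm{Val}_{\mathrm{LO}^{\mathrm{cond}}}(L,\mathcal L^{\Diamond}_{\le}(L))=\mathsf{S4.2.1}$. Consequently, the set of propositional modal formulas valid at every world $W$ of $\mathrm{LO}^{\mathrm{cond}}$ with respect to $\mathcal L^{\Diamond}_{\le}(W)$ is exactly $\mathsf{S4.2.1}$.
   Context: A linear order is scattered if it contains no copy of $(\mathbb Q,\le)$. A condensation is a surjective monotone map between nonempty linear orders; $\mathrm{LO}^{\mathrm{cond}}$ is the category of nonempty linear orders and condensations. $\mathcal L^{\Diamond}_{\le}(W)$ is the modal extension (operators $\Diamond,\Box$) of $\{\le\}$ with constants naming elements of $W$ (transported along morphisms). Modal satisfaction: $U\models\Diamond\varphi[\nu]$ iff there is a morphism $f:U\to V$ with $V\models\varphi[f\circ\nu]$; $\Box$ dually. $\mathrm{Val}(W,\Gamma)$ is the set of propositional modal formulas $\psi(p_0,\dots,p_n)$ all of whose substitution instances $\psi(\varphi_0,\dots,\varphi_n)$ with $\varphi_i\in\Gamma$ hold at $W$. $\mathsf{S4.2.1}$ is the normal modal logic axiomatized by $\Box p\to p$, $\Box p\to\Box\Box p$, $\Diamond\Box p\to\Box\Diamond p$, and $\Box\Diamond p\to\Diamond\Box p$. *)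

theory Defs
  imports Complex_Main
begin

text \<open>
  A linear order is represented by its (reflexive) order relation \<open>r\<close>; its carrier is \<open>Field r\<close>,
  an arbitrary subset of the type \<open>'a\<close>.
\<close>

definition lo :: "'a rel \<Rightarrow> bool" where
  "lo r \<longleftrightarrow> Linear_order r \<and> Field r \<noteq> {}"

definition condensation :: "'a rel \<Rightarrow> 'b rel \<Rightarrow> ('a \<Rightarrow> 'b) \<Rightarrow> bool" where
  "condensation r s f \<longleftrightarrow>
     (\<forall>x y. (x, y) \<in> r \<longrightarrow> (f x, f y) \<in> s) \<and> f ` Field r = Field s"

definition scattered :: "'a rel \<Rightarrow> bool" where
  "scattered r \<longleftrightarrow> \<not> (\<exists>e :: rat \<Rightarrow> 'a. \<forall>x y. x \<le> y \<longleftrightarrow> (e x, e y) \<in> r)"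


subsection \<open>The modal first-order language of orders\<close>

text \<open>\<open>'c\<close> is the type of names of constants.\<close>

datatype 'c trm = Var nat | Const 'c

datatype 'c fm =
    Eq "'c trm" "'c trm"
  | Le "'c trm" "'c trm"
  | Fls
  | Imp "'c fm" "'c fm"
  | All nat "'c fm"
  | Box "'c fm"

abbreviation Neg :: "'c fm \<Rightarrow> 'c fm" where "Neg \<phi> \<equiv> Imp \<phi> Fls"
abbreviation Ex :: "nat \<Rightarrow> 'c fm \<Rightarrow> 'c fm" where "Ex n \<phi> \<equiv> Neg (All n (Neg \<phi>))"
abbreviation Dia :: "'c fm \<Rightarrow> 'c fm" where "Dia \<phi> \<equiv> Neg (Box (Neg \<phi>))"

fun tfv :: "'c trm \<Rightarrow> nat set" where
  "tfv (Var n) = {n}"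
| "tfv (Const c) = {}"

fun fv :: "'c fm \<Rightarrow> nat set" where
  "fv (Eq s t) = tfv s \<union> tfv t"
| "fv (Le s t) = tfv s \<union> tfv t"
| "fv Fls = {}"
| "fv (Imp \<phi> \<psi>) = fv \<phi> \<union> fv \<psi>"
| "fv (All n \<phi>) = fv \<phi> - {n}"
| "fv (Box \<phi>) = fv \<phi>"

fun tval :: "('c \<Rightarrow> 'a) \<Rightarrow> (nat \<Rightarrow> 'a) \<Rightarrow> 'c trm \<Rightarrow> 'a" where
  "tval \<iota> \<nu> (Var n) = \<nu> n"
| "tval \<iota> \<nu> (Const c) = \<iota> c"

text \<open>
  \<open>\<iota>\<close> interprets the constants in the current world and \<open>\<nu>\<close> the variables; both are transported
  along morphisms. In the modal clause the target \<open>V\<close> ranges over orders on subsets of the same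
  type as \<open>U\<close>. Since condensations are surjective, every condensation out of \<open>U\<close> is, up to
  isomorphism, one onto an order on a subset of \<open>Field U\<close>, so nothing is lost; the lemmas
  \<open>sat_Box_any\<close> and \<open>sat_Dia_any\<close> below give the modal clauses for targets of arbitrary type.
\<close>

primrec sat :: "'a rel \<Rightarrow> ('c \<Rightarrow> 'a) \<Rightarrow> (nat \<Rightarrow> 'a) \<Rightarrow> 'c fm \<Rightarrow> bool" where
  "sat U \<iota> \<nu> (Eq s t) \<longleftrightarrow> tval \<iota> \<nu> s = tval \<iota> \<nu> t"
| "sat U \<iota> \<nu> (Le s t) \<longleftrightarrow> (tval \<iota> \<nu> s, tval \<iota> \<nu> t) \<in> U"
| "sat U \<iota> \<nu> Fls \<longleftrightarrow> False"
| "sat U \<iota> \<nu> (Imp \<phi> \<psi>) \<longleftrightarrow> (sat U \<iota> \<nu> \<phi> \<longrightarrow> sat U \<iota> \<nu> \<psi>)"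
| "sat U \<iota> \<nu> (All n \<phi>) \<longleftrightarrow> (\<forall>x\<in>Field U. sat U \<iota> (\<nu>(n := x)) \<phi>)"
| "sat U \<iota> \<nu> (Box \<phi>) \<longleftrightarrow>
     (\<forall>V f. lo V \<and> condensation U V f \<longrightarrow> sat V (f \<circ> \<iota>) (f \<circ> \<nu>) \<phi>)"

lemma sat_Dia:
  fixes U :: "'a rel"
  shows "sat U \<iota> \<nu> (Dia \<phi>) \<longleftrightarrow>
     (\<exists>(V :: 'a rel) f. lo V \<and> condensation U V f \<and> sat V (f \<circ> \<iota>) (f \<circ> \<nu>) \<phi>)"
  by auto

lemma sat_Ex: "sat U \<iota> \<nu> (Ex n \<phi>) \<longleftrightarrow> (\<exists>x\<in>Field U. sat U \<iota> (\<nu>(n := x)) \<phi>)"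
  by auto

text \<open>The sentences with parameters from the world \<open>W\<close>, elements serving as their own names.\<close>

definition lang :: "'a rel \<Rightarrow> 'a fm set" where
  "lang W = {\<phi>. fv \<phi> = {} \<and> set_fm \<phi> \<subseteq> Field W}"

definition holds :: "'a rel \<Rightarrow> 'a fm \<Rightarrow> bool" where
  "holds W \<phi> \<longleftrightarrow> (\<forall>\<nu>. range \<nu> \<subseteq> Field W \<longrightarrow> sat W id \<nu> \<phi>)"


subsection \<open>Propositional modal logic\<close>

datatype pfm =
    PVar nat
  | PFls
  | PImp pfm pfm  (infixr "\<rightarrow>\<^sub>p" 55)
  | PBox pfm  ("\<box>\<^sub>p _" [60] 60)

abbreviation PNeg :: "pfm \<Rightarrow> pfm"  ("\<not>\<^sub>p _" [60] 60) where "\<not>\<^sub>p \<phi> \<equiv> \<phi> \<rightarrow>\<^sub>p PFls"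
abbreviation PDia :: "pfm \<Rightarrow> pfm"  ("\<diamond>\<^sub>p _" [60] 60) where "\<diamond>\<^sub>p \<phi> \<equiv> \<not>\<^sub>p \<box>\<^sub>p \<not>\<^sub>p \<phi>"

fun psubst :: "(nat \<Rightarrow> pfm) \<Rightarrow> pfm \<Rightarrow> pfm" where
  "psubst \<sigma> (PVar n) = \<sigma> n"
| "psubst \<sigma> PFls = PFls"
| "psubst \<sigma> (\<phi> \<rightarrow>\<^sub>p \<psi>) = psubst \<sigma> \<phi> \<rightarrow>\<^sub>p psubst \<sigma> \<psi>"
| "psubst \<sigma> (\<box>\<^sub>p \<phi>) = \<box>\<^sub>p psubst \<sigma> \<phi>"

text \<open>Classical evaluation; variables and boxed formulas count as atoms.\<close>

fun peval :: "(pfm \<Rightarrow> bool) \<Rightarrow> pfm \<Rightarrow> bool" where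
  "peval v (PVar n) = v (PVar n)"
| "peval v PFls = False"
| "peval v (\<phi> \<rightarrow>\<^sub>p \<psi>) = (peval v \<phi> \<longrightarrow> peval v \<psi>)"
| "peval v (\<box>\<^sub>p \<phi>) = v (\<box>\<^sub>p \<phi>)"

definition tautology :: "pfm \<Rightarrow> bool" where
  "tautology \<phi> \<longleftrightarrow> (\<forall>v. peval v \<phi>)"

inductive_set normal_logic :: "pfm set \<Rightarrow> pfm set" for A where
  taut: "tautology \<phi> \<Longrightarrow> \<phi> \<in> normal_logic A"
| K: "\<box>\<^sub>p (\<phi> \<rightarrow>\<^sub>p \<psi>) \<rightarrow>\<^sub>p \<box>\<^sub>p \<phi> \<rightarrow>\<^sub>p \<box>\<^sub>p \<psi> \<in> normal_logic A"
| ax: "\<phi> \<in> A \<Longrightarrow> \<phi> \<in> normal_logic A"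
| MP: "\<phi> \<rightarrow>\<^sub>p \<psi> \<in> normal_logic A \<Longrightarrow> \<phi> \<in> normal_logic A \<Longrightarrow> \<psi> \<in> normal_logic A"
| Nec: "\<phi> \<in> normal_logic A \<Longrightarrow> \<box>\<^sub>p \<phi> \<in> normal_logic A"
| Sub: "\<phi> \<in> normal_logic A \<Longrightarrow> psubst \<sigma> \<phi> \<in> normal_logic A"

definition S421 :: "pfm set" where
  "S421 = (let p = PVar 0 in normal_logic
     {\<box>\<^sub>p p \<rightarrow>\<^sub>p p,
      \<box>\<^sub>p p \<rightarrow>\<^sub>p \<box>\<^sub>p \<box>\<^sub>p p,
      \<diamond>\<^sub>p \<box>\<^sub>p p \<rightarrow>\<^sub>p \<box>\<^sub>p \<diamond>\<^sub>p p,
      \<box>\<^sub>p \<diamond>\<^sub>p p \<rightarrow>\<^sub>p \<diamond>\<^sub>p \<box>\<^sub>p p})"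


subsection \<open>Validities\<close>

fun inst :: "(nat \<Rightarrow> 'c fm) \<Rightarrow> pfm \<Rightarrow> 'c fm" where
  "inst \<sigma> (PVar n) = \<sigma> n"
| "inst \<sigma> PFls = Fls"
| "inst \<sigma> (\<phi> \<rightarrow>\<^sub>p \<psi>) = Imp (inst \<sigma> \<phi>) (inst \<sigma> \<psi>)"
| "inst \<sigma> (\<box>\<^sub>p \<phi>) = Box (inst \<sigma> \<phi>)"

definition Val :: "'a rel \<Rightarrow> 'a fm set \<Rightarrow> pfm set" where
  "Val W \<Gamma> = {\<psi>. \<forall>\<sigma>. range \<sigma> \<subseteq> \<Gamma> \<longrightarrow> holds W (inst \<sigma> \<psi>)}"


subsection \<open>Targets of arbitrary type\<close>

definition oiso :: "'a rel \<Rightarrow> 'b rel \<Rightarrow> ('a \<Rightarrow> 'b) \<Rightarrow> bool" where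
  "oiso r s h \<longleftrightarrow> bij_betw h (Field r) (Field s) \<and>
     (\<forall>x\<in>Field r. \<forall>y\<in>Field r. (x, y) \<in> r \<longleftrightarrow> (h x, h y) \<in> s)"

lemma oiso_inv:
  assumes "oiso r s h"
  shows "oiso s r (inv_into (Field r) h)"
proof -
  let ?g = "inv_into (Field r) h"
  have b: "bij_betw h (Field r) (Field s)" using assms by (simp add: oiso_def)
  have bg: "bij_betw ?g (Field s) (Field r)" using b by (rule bij_betw_inv_into)
  have "(x, y) \<in> s \<longleftrightarrow> (?g x, ?g y) \<in> r" if "x \<in> Field s" "y \<in> Field s" for x y
  proof -
    have "?g x \<in> Field r" "?g y \<in> Field r" using bg that by (auto dest: bij_betwE)
    moreover have "h (?g x) = x" "h (?g y) = y"
      using b that by (simp_all add: bij_betw_inv_into_right)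
    ultimately show ?thesis using assms by (metis oiso_def)
  qed
  then show ?thesis using bg by (simp add: oiso_def)
qed

lemma lo_transfer:
  assumes "lo r" and inj: "inj_on k (Field r)"
  defines "s \<equiv> (\<lambda>(x, y). (k x, k y)) ` r"
  shows "lo s" "oiso r s k" "Field s = k ` Field r"
proof -
  have lin: "Linear_order r" and ne: "Field r \<noteq> {}" using assms(1) by (auto simp: lo_def)
  show F: "Field s = k ` Field r" by (force simp: s_def Field_def)
  have iff: "(k x, k y) \<in> s \<longleftrightarrow> (x, y) \<in> r" if "x \<in> Field r" "y \<in> Field r" for x y
  proof
    assume "(k x, k y) \<in> s"
    then obtain x' y' where "(x', y') \<in> r" "k x = k x'" "k y = k y'" by (auto simp: s_def)
    moreover from this have "x' \<in> Field r" "y' \<in> Field r" by (auto simp: Field_def)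
    ultimately show "(x, y) \<in> r" using inj that by (metis inj_onD)
  qed (force simp: s_def)
  show "oiso r s k" using inj F iff by (simp add: oiso_def bij_betw_def)
  have r: "(x, x) \<in> r" if "x \<in> Field r" for x
    using lin that by (auto simp: order_on_defs refl_on_def)
  have t: "(x, z) \<in> r" if "(x, y) \<in> r" "(y, z) \<in> r" for x y z
    using lin that by (meson order_on_defs transD)
  have a: "x = y" if "(x, y) \<in> r" "(y, x) \<in> r" for x y
    using lin that by (meson order_on_defs antisymD)
  have l: "(x, y) \<in> r \<or> (y, x) \<in> r" if "x \<in> Field r" "y \<in> Field r" for x y
    using lin that r by (metis order_on_defs(3) total_on_def)
  have "refl_on (Field s) s" using F iff r by (auto simp: refl_on_def)
  moreover have "s \<subseteq> Field s \<times> Field s" by (auto simp: Field_def)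
  moreover have "trans s"
  proof (rule transI)
    fix u v w assume h: "(u, v) \<in> s" "(v, w) \<in> s"
    then have "u \<in> Field s" "v \<in> Field s" "w \<in> Field s" by (auto simp: Field_def)
    then show "(u, w) \<in> s" using h F iff t by (smt (verit) imageE)
  qed
  moreover have "antisym s"
  proof (rule antisymI)
    fix u v assume h: "(u, v) \<in> s" "(v, u) \<in> s"
    then have "u \<in> Field s" "v \<in> Field s" by (auto simp: Field_def)
    then show "u = v" using h F iff a by (smt (verit) imageE)
  qed
  moreover have "total_on (Field s) s" using F iff l by (auto simp: total_on_def)
  ultimately show "lo s" using F ne by (simp add: lo_def order_on_defs)
qed

text \<open>
  Any condensation \<open>f : r \<rightarrow> v\<close>, of whatever type, is reproduced on the other side of an
  isomorphism \<open>h : r \<rightarrow> r'\<close> by a condensation between orders on the type of \<open>r'\<close>.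
\<close>

lemma condensation_transfer:
  fixes r :: "'a rel" and r' :: "'b rel" and v :: "'d rel"
  assumes r': "lo r'" and h: "oiso r r' h" and v: "lo v" and f: "condensation r v f"
  obtains v' :: "'b rel" and f' :: "'b \<Rightarrow> 'b" and k :: "'d \<Rightarrow> 'b"
  where "lo v'" "condensation r' v' f'" "oiso v v' k" "\<forall>x\<in>Field r. f' (h x) = k (f x)"
proof -
  define k where "k = h \<circ> inv_into (Field r) f"
  define g where "g = inv_into (Field r) h"
  define f' where "f' = k \<circ> f \<circ> g"
  define v' where "v' = (\<lambda>(x, y). (k x, k y)) ` v"
  have b: "bij_betw h (Field r) (Field r')" using h by (simp add: oiso_def)
  have fF: "f ` Field r = Field v" using f by (simp add: condensation_def)
  have "inj_on (inv_into (Field r) f) (Field v)" by (metis fF inj_on_inv_into subset_refl)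
  moreover have "inv_into (Field r) f ` Field v \<subseteq> Field r"
    using fF by (auto intro: inv_into_into)
  ultimately have inj: "inj_on k (Field v)"
    unfolding k_def using b by (meson bij_betw_def comp_inj_on inj_on_subset)
  note T = lo_transfer[OF v inj, folded v'_def]
  have gi: "oiso r' r g" unfolding g_def using h by (rule oiso_inv)
  have gF: "g ` Field r' = Field r" using gi by (simp add: oiso_def bij_betw_def)
  have eq: "\<forall>x\<in>Field r. f' (h x) = k (f x)"
    using b by (simp add: f'_def g_def bij_betw_inv_into_left)
  have "(f' x, f' y) \<in> v'" if xy: "(x, y) \<in> r'" for x y
  proof -
    have "x \<in> Field r'" "y \<in> Field r'" using xy by (auto simp: Field_def)
    then have "(g x, g y) \<in> r" using gi xy by (simp add: oiso_def)
    then have "(f (g x), f (g y)) \<in> v" using f by (simp add: condensation_def)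
    then show ?thesis by (force simp: f'_def v'_def)
  qed
  moreover have "f' ` Field r' = Field v'"
    unfolding f'_def image_comp[symmetric] gF fF T(3) ..
  ultimately have "condensation r' v' f'" by (simp add: condensation_def)
  with T eq show thesis using that by blast
qed

lemma tval_cong:
  assumes "\<forall>c\<in>set_trm t. \<iota> c = \<iota>' c" "\<forall>n\<in>tfv t. \<nu> n = \<nu>' n"
  shows "tval \<iota> \<nu> t = tval \<iota>' \<nu>' t"
  using assms by (cases t) auto

lemma sat_cong:
  fixes U :: "'a rel"
  assumes "\<forall>c\<in>set_fm \<phi>. \<iota> c = \<iota>' c" "\<forall>n\<in>fv \<phi>. \<nu> n = \<nu>' n"
  shows "sat U \<iota> \<nu> \<phi> \<longleftrightarrow> sat U \<iota>' \<nu>' \<phi>"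
  using assms
proof (induction \<phi> arbitrary: U \<iota> \<iota>' \<nu> \<nu>')
  case (Eq s t)
  have "tval \<iota> \<nu> s = tval \<iota>' \<nu>' s" "tval \<iota> \<nu> t = tval \<iota>' \<nu>' t"
    by (rule tval_cong; use Eq in simp)+
  then show ?case by simp
next
  case (Le s t)
  have "tval \<iota> \<nu> s = tval \<iota>' \<nu>' s" "tval \<iota> \<nu> t = tval \<iota>' \<nu>' t"
    by (rule tval_cong; use Le in simp)+
  then show ?case by simp
next
  case Fls
  then show ?case by simp
next
  case (Imp \<phi> \<psi>)
  have "sat U \<iota> \<nu> \<phi> \<longleftrightarrow> sat U \<iota>' \<nu>' \<phi>" "sat U \<iota> \<nu> \<psi> \<longleftrightarrow> sat U \<iota>' \<nu>' \<psi>"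
    by (rule Imp.IH; use Imp.prems in simp)+
  then show ?case by simp
next
  case (All n \<phi>)
  have "sat U \<iota> (\<nu>(n := x)) \<phi> \<longleftrightarrow> sat U \<iota>' (\<nu>'(n := x)) \<phi>" for x
    by (rule All.IH) (use All.prems in auto)
  then show ?case by simp
next
  case (Box \<phi>)
  have "sat V (f \<circ> \<iota>) (f \<circ> \<nu>) \<phi> \<longleftrightarrow> sat V (f \<circ> \<iota>') (f \<circ> \<nu>') \<phi>" for V :: "'a rel" and f
    by (rule Box.IH) (use Box.prems in auto)
  then show ?case by simp
qed

lemma tval_oiso:
  assumes "\<forall>c\<in>set_trm t. \<iota> c \<in> Field U" "\<forall>n\<in>tfv t. \<nu> n \<in> Field U"
  shows "tval (h \<circ> \<iota>) (h \<circ> \<nu>) t = h (tval \<iota> \<nu> t)" "tval \<iota> \<nu> t \<in> Field U"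
  using assms by (cases t; auto)+

lemma sat_oiso:
  fixes U :: "'a rel" and U' :: "'b rel"
  assumes "lo U" "lo U'" "oiso U U' h"
    and "\<forall>c\<in>set_fm \<phi>. \<iota> c \<in> Field U" "\<forall>n\<in>fv \<phi>. \<nu> n \<in> Field U"
  shows "sat U \<iota> \<nu> \<phi> \<longleftrightarrow> sat U' (h \<circ> \<iota>) (h \<circ> \<nu>) \<phi>"
  using assms
proof (induction \<phi> arbitrary: U U' h \<iota> \<nu>)
  case (Eq s t)
  have s: "\<forall>c\<in>set_trm s. \<iota> c \<in> Field U" "\<forall>n\<in>tfv s. \<nu> n \<in> Field U"
    and t: "\<forall>c\<in>set_trm t. \<iota> c \<in> Field U" "\<forall>n\<in>tfv t. \<nu> n \<in> Field U"
    using Eq by auto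
  have "inj_on h (Field U)" using Eq by (simp add: oiso_def bij_betw_def)
  then show ?case using tval_oiso(1)[OF s, of h] tval_oiso(1)[OF t, of h]
      tval_oiso(2)[OF s] tval_oiso(2)[OF t]
    by (simp add: inj_on_eq_iff comp_def)
next
  case (Le s t)
  have s: "\<forall>c\<in>set_trm s. \<iota> c \<in> Field U" "\<forall>n\<in>tfv s. \<nu> n \<in> Field U"
    and t: "\<forall>c\<in>set_trm t. \<iota> c \<in> Field U" "\<forall>n\<in>tfv t. \<nu> n \<in> Field U"
    using Le by auto
  then show ?case using tval_oiso(1)[OF s, of h] tval_oiso(1)[OF t, of h]
      tval_oiso(2)[OF s] tval_oiso(2)[OF t] Le.prems(3)
    by (simp add: oiso_def comp_def)
next
  case Fls
  then show ?case by simp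
next
  case (Imp \<phi> \<psi>)
  have "sat U \<iota> \<nu> \<phi> \<longleftrightarrow> sat U' (h \<circ> \<iota>) (h \<circ> \<nu>) \<phi>"
    by (rule Imp.IH(1)) (use Imp.prems in auto)
  moreover have "sat U \<iota> \<nu> \<psi> \<longleftrightarrow> sat U' (h \<circ> \<iota>) (h \<circ> \<nu>) \<psi>"
    by (rule Imp.IH(2)) (use Imp.prems in auto)
  ultimately show ?case by (simp add: comp_def)
next
  case (All n \<phi>)
  have "sat U \<iota> (\<nu>(n := x)) \<phi> \<longleftrightarrow> sat U' (h \<circ> \<iota>) ((h \<circ> \<nu>)(n := h x)) \<phi>"
    if "x \<in> Field U" for x
  proof -
    have "sat U \<iota> (\<nu>(n := x)) \<phi> \<longleftrightarrow> sat U' (h \<circ> \<iota>) (h \<circ> (\<nu>(n := x))) \<phi>"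
      by (rule All.IH) (use All.prems that in auto)
    then show ?thesis by (simp add: fun_upd_comp)
  qed
  moreover have "Field U' = h ` Field U" using All.prems by (simp add: oiso_def bij_betw_def)
  ultimately show ?case by (simp add: comp_def)
next
  case (Box \<phi>)
  let ?g = "inv_into (Field U) h"
  have b: "bij_betw h (Field U) (Field U')" using Box.prems by (simp add: oiso_def)
  have c: "\<forall>c\<in>set_fm \<phi>. \<iota> c \<in> Field U" and n: "\<forall>n\<in>fv \<phi>. \<nu> n \<in> Field U"
    using Box.prems by auto
  have step: "sat V (f \<circ> \<iota>) (f \<circ> \<nu>) \<phi> \<longleftrightarrow> sat V' (f' \<circ> (h \<circ> \<iota>)) (f' \<circ> (h \<circ> \<nu>)) \<phi>"
    if V: "lo V" "condensation U V f" "lo V'" "oiso V V' k"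
      and eq: "\<forall>x\<in>Field U. f' (h x) = k (f x)"
    for V :: "'a rel" and V' :: "'b rel" and f f' k
  proof -
    have fF: "f ` Field U = Field V" using V by (simp add: condensation_def)
    have "sat V (f \<circ> \<iota>) (f \<circ> \<nu>) \<phi> \<longleftrightarrow> sat V' (k \<circ> (f \<circ> \<iota>)) (k \<circ> (f \<circ> \<nu>)) \<phi>"
      by (rule Box.IH) (use V c n fF in auto)
    also have "\<dots> \<longleftrightarrow> sat V' (f' \<circ> (h \<circ> \<iota>)) (f' \<circ> (h \<circ> \<nu>)) \<phi>"
      by (rule sat_cong) (use eq c n in auto)
    finally show ?thesis .
  qed
  show ?case
  proof
    assume L: "sat U \<iota> \<nu> (Box \<phi>)"
    have "sat V' (f' \<circ> (h \<circ> \<iota>)) (f' \<circ> (h \<circ> \<nu>)) \<phi>"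
      if V': "lo V'" "condensation U' V' f'" for V' :: "'b rel" and f'
    proof -
      obtain V :: "'a rel" and f k where
        V: "lo V" "condensation U V f" "oiso V' V k" "\<forall>x\<in>Field U'. f (?g x) = k (f' x)"
        using condensation_transfer[OF Box.prems(1) oiso_inv[OF Box.prems(3)] V'] by blast
      let ?k = "inv_into (Field V') k"
      have "\<forall>x\<in>Field U. f' (h x) = ?k (f x)"
      proof
        fix x assume x: "x \<in> Field U"
        then have hx: "h x \<in> Field U'" using b by (auto dest: bij_betwE)
        then have "f x = k (f' (h x))"
          using V(4) x b by (metis bij_betw_inv_into_left)
        moreover have "f' (h x) \<in> Field V'" using hx V' by (auto simp: condensation_def)
        moreover have "bij_betw k (Field V') (Field V)" using V by (simp add: oiso_def)
        ultimately show "f' (h x) = ?k (f x)" by (simp add: bij_betw_inv_into_left)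
      qed
      from step[OF V(1,2) V'(1) oiso_inv[OF V(3)] this] show ?thesis using L V by (simp add: comp_def)
    qed
    then show "sat U' (h \<circ> \<iota>) (h \<circ> \<nu>) (Box \<phi>)" by (simp add: comp_def)
  next
    assume R: "sat U' (h \<circ> \<iota>) (h \<circ> \<nu>) (Box \<phi>)"
    have "sat V (f \<circ> \<iota>) (f \<circ> \<nu>) \<phi>" if V: "lo V" "condensation U V f" for V :: "'a rel" and f
    proof -
      obtain V' :: "'b rel" and f' k where
        V': "lo V'" "condensation U' V' f'" "oiso V V' k" "\<forall>x\<in>Field U. f' (h x) = k (f x)"
        using condensation_transfer[OF Box.prems(2,3) V] by blast
      from step[OF V V'(1,3,4)] show ?thesis using R V' by (simp add: comp_def)
    qed
    then show "sat U \<iota> \<nu> (Box \<phi>)" by (simp add: comp_def)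
  qed
qed

lemma sat_Box_any:
  fixes U :: "'a rel" and V :: "'b rel"
  assumes U: "lo U" and i: "\<forall>c\<in>set_fm \<phi>. \<iota> c \<in> Field U" "\<forall>n\<in>fv \<phi>. \<nu> n \<in> Field U"
    and box: "sat U \<iota> \<nu> (Box \<phi>)"
    and V: "lo V" "condensation U V f"
  shows "sat V (f \<circ> \<iota>) (f \<circ> \<nu>) \<phi>"
proof -
  have "oiso U U id" by (simp add: oiso_def)
  from condensation_transfer[OF U this V] obtain V' :: "'a rel" and f' k where
    V': "lo V'" "condensation U V' f'" "oiso V V' k" "\<forall>x\<in>Field U. f' x = k (f x)"
    by auto
  have fF: "f ` Field U = Field V" using V by (simp add: condensation_def)
  have "sat V (f \<circ> \<iota>) (f \<circ> \<nu>) \<phi> \<longleftrightarrow> sat V' (k \<circ> (f \<circ> \<iota>)) (k \<circ> (f \<circ> \<nu>)) \<phi>"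
    by (rule sat_oiso) (use V V' i fF in auto)
  also have "\<dots> \<longleftrightarrow> sat V' (f' \<circ> \<iota>) (f' \<circ> \<nu>) \<phi>"
    by (rule sat_cong) (use V' i in auto)
  finally show ?thesis using box V' by (simp add: comp_def)
qed

lemma sat_Dia_any:
  fixes U :: "'a rel" and V :: "'b rel"
  assumes U: "lo U" and i: "\<forall>c\<in>set_fm \<phi>. \<iota> c \<in> Field U" "\<forall>n\<in>fv \<phi>. \<nu> n \<in> Field U"
    and V: "lo V" "condensation U V f" "sat V (f \<circ> \<iota>) (f \<circ> \<nu>) \<phi>"
  shows "sat U \<iota> \<nu> (Dia \<phi>)"
  using sat_Box_any[OF U, of "Neg \<phi>" \<iota> \<nu> V f] i V by (auto simp: comp_def)

end

theory Submission
  imports Defs "HOL-Library.Countable"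
begin

text \<open>
  Soundness: every world condenses onto the one-point order, which has no proper condensations.

  Completeness: a non-theorem of S4.2.1 fails in a finite preorder with a single final point \<open>t\<close>.
  Given such a frame with \<open>N\<close> points and a non-scattered \<open>L\<close>, choose \<open>a\<^sub>0 < \<dots> < a\<^sub>N\<close> in a copy of
  the rationals in \<open>L\<close>. The equations \<open>a\<^sub>i = a\<^sub>i\<^sub>+\<^sub>1\<close> are independent buttons, one for each point of the
  frame; the number of successive covers above \<open>a\<^sub>N\<close> is a dial which can be reset at will as long
  as the part above \<open>a\<^sub>N\<close> is non-scattered, which the modal language
  expresses as being possibly dense. The greatest
  pressed button determines a cluster and the dial a point in it; if the pressed buttons are not
  a chain, or the dial is broken, the point is \<open>t\<close>. This maps the condensations of \<open>L\<close> onto the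
  frame by a definable bounded morphism, so the countermodel is reproduced at \<open>L\<close>.
\<close>

subsection \<open>Maximal consistent sets of S4.2.1\<close>

text \<open>Closure is under modus ponens alone: necessitation and substitution preserve validity
  but not truth at a world, and worlds are to be deductive sets.\<close>

definition deductive :: "pfm set \<Rightarrow> bool" where
  "deductive \<Gamma> \<longleftrightarrow> S421 \<subseteq> \<Gamma> \<and> (\<forall>\<phi> \<psi>. \<phi> \<rightarrow>\<^sub>p \<psi> \<in> \<Gamma> \<longrightarrow> \<phi> \<in> \<Gamma> \<longrightarrow> \<psi> \<in> \<Gamma>)"

definition mcs :: "pfm set \<Rightarrow> bool" where
  "mcs w \<longleftrightarrow> deductive w \<and> PFls \<notin> w \<and> (\<forall>\<phi>. \<phi> \<in> w \<or> \<not>\<^sub>p \<phi> \<in> w)"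

definition canon :: "pfm set \<Rightarrow> pfm set \<Rightarrow> bool" where
  "canon w v \<longleftrightarrow> (\<forall>\<phi>. \<box>\<^sub>p \<phi> \<in> w \<longrightarrow> \<phi> \<in> v)"

lemma S421_taut: "tautology \<phi> \<Longrightarrow> \<phi> \<in> S421"
  by (simp add: S421_def normal_logic.taut Let_def)

lemma S421_K: "\<box>\<^sub>p (\<phi> \<rightarrow>\<^sub>p \<psi>) \<rightarrow>\<^sub>p \<box>\<^sub>p \<phi> \<rightarrow>\<^sub>p \<box>\<^sub>p \<psi> \<in> S421"
  by (simp add: S421_def normal_logic.K Let_def)

lemma S421_MP: "\<phi> \<rightarrow>\<^sub>p \<psi> \<in> S421 \<Longrightarrow> \<phi> \<in> S421 \<Longrightarrow> \<psi> \<in> S421"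
  unfolding S421_def Let_def by (rule normal_logic.MP)

lemma S421_Nec: "\<phi> \<in> S421 \<Longrightarrow> \<box>\<^sub>p \<phi> \<in> S421"
  unfolding S421_def Let_def by (rule normal_logic.Nec)

lemma S421_axioms:
  shows S421_T: "\<box>\<^sub>p \<phi> \<rightarrow>\<^sub>p \<phi> \<in> S421"
    and S421_4: "\<box>\<^sub>p \<phi> \<rightarrow>\<^sub>p \<box>\<^sub>p \<box>\<^sub>p \<phi> \<in> S421"
    and S421_dot2: "\<diamond>\<^sub>p \<box>\<^sub>p \<phi> \<rightarrow>\<^sub>p \<box>\<^sub>p \<diamond>\<^sub>p \<phi> \<in> S421"
    and S421_dot1: "\<box>\<^sub>p \<diamond>\<^sub>p \<phi> \<rightarrow>\<^sub>p \<diamond>\<^sub>p \<box>\<^sub>p \<phi> \<in> S421"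
proof -
  let ?p = "PVar 0"
  have inst: "psubst (\<lambda>_. \<phi>) \<chi> \<in> S421" if "\<chi> \<in> {\<box>\<^sub>p ?p \<rightarrow>\<^sub>p ?p, \<box>\<^sub>p ?p \<rightarrow>\<^sub>p \<box>\<^sub>p \<box>\<^sub>p ?p,
      \<diamond>\<^sub>p \<box>\<^sub>p ?p \<rightarrow>\<^sub>p \<box>\<^sub>p \<diamond>\<^sub>p ?p, \<box>\<^sub>p \<diamond>\<^sub>p ?p \<rightarrow>\<^sub>p \<diamond>\<^sub>p \<box>\<^sub>p ?p}" for \<chi>
    unfolding S421_def Let_def by (rule normal_logic.Sub[OF normal_logic.ax[OF that]])
  show "\<box>\<^sub>p \<phi> \<rightarrow>\<^sub>p \<phi> \<in> S421" using inst[of "\<box>\<^sub>p ?p \<rightarrow>\<^sub>p ?p"] by simp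
  show "\<box>\<^sub>p \<phi> \<rightarrow>\<^sub>p \<box>\<^sub>p \<box>\<^sub>p \<phi> \<in> S421" using inst[of "\<box>\<^sub>p ?p \<rightarrow>\<^sub>p \<box>\<^sub>p \<box>\<^sub>p ?p"] by simp
  show "\<diamond>\<^sub>p \<box>\<^sub>p \<phi> \<rightarrow>\<^sub>p \<box>\<^sub>p \<diamond>\<^sub>p \<phi> \<in> S421" using inst[of "\<diamond>\<^sub>p \<box>\<^sub>p ?p \<rightarrow>\<^sub>p \<box>\<^sub>p \<diamond>\<^sub>p ?p"] by simp
  show "\<box>\<^sub>p \<diamond>\<^sub>p \<phi> \<rightarrow>\<^sub>p \<diamond>\<^sub>p \<box>\<^sub>p \<phi> \<in> S421" using inst[of "\<box>\<^sub>p \<diamond>\<^sub>p ?p \<rightarrow>\<^sub>p \<diamond>\<^sub>p \<box>\<^sub>p ?p"] by simp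
qed

lemma deductive_MP: "deductive \<Gamma> \<Longrightarrow> \<phi> \<rightarrow>\<^sub>p \<psi> \<in> \<Gamma> \<Longrightarrow> \<phi> \<in> \<Gamma> \<Longrightarrow> \<psi> \<in> \<Gamma>"
  by (auto simp: deductive_def)

lemma deductive_taut: "deductive \<Gamma> \<Longrightarrow> tautology \<phi> \<Longrightarrow> \<phi> \<in> \<Gamma>"
  by (auto simp: deductive_def S421_taut)

lemma deductive_S421: "deductive S421"
  by (auto simp: deductive_def intro: S421_MP)

text \<open>The deduction theorem lets this set stand for the theory generated by
  \<open>\<Gamma>\<close> and \<open>\<chi>\<close>, so derivations from premises need no definition
  of their own.\<close>

lemma deductive_implied:
  assumes "deductive \<Gamma>"
  shows "deductive {\<theta>. \<chi> \<rightarrow>\<^sub>p \<theta> \<in> \<Gamma>}" "\<Gamma> \<subseteq> {\<theta>. \<chi> \<rightarrow>\<^sub>p \<theta> \<in> \<Gamma>}" "\<chi> \<in> {\<theta>. \<chi> \<rightarrow>\<^sub>p \<theta> \<in> \<Gamma>}"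
proof -
  show *: "\<Gamma> \<subseteq> {\<theta>. \<chi> \<rightarrow>\<^sub>p \<theta> \<in> \<Gamma>}"
  proof
    fix \<theta> assume "\<theta> \<in> \<Gamma>"
    moreover have "\<theta> \<rightarrow>\<^sub>p \<chi> \<rightarrow>\<^sub>p \<theta> \<in> \<Gamma>"
      by (rule deductive_taut[OF assms]) (simp add: tautology_def)
    ultimately show "\<theta> \<in> {\<theta>. \<chi> \<rightarrow>\<^sub>p \<theta> \<in> \<Gamma>}" using deductive_MP[OF assms] by blast
  qed
  show "\<chi> \<in> {\<theta>. \<chi> \<rightarrow>\<^sub>p \<theta> \<in> \<Gamma>}"
    by (auto intro!: deductive_taut[OF assms] simp: tautology_def)
  have "\<chi> \<rightarrow>\<^sub>p \<psi> \<in> \<Gamma>" if "\<chi> \<rightarrow>\<^sub>p \<phi> \<rightarrow>\<^sub>p \<psi> \<in> \<Gamma>" "\<chi> \<rightarrow>\<^sub>p \<phi> \<in> \<Gamma>" for \<phi> \<psi>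
  proof -
    have "(\<chi> \<rightarrow>\<^sub>p \<phi> \<rightarrow>\<^sub>p \<psi>) \<rightarrow>\<^sub>p (\<chi> \<rightarrow>\<^sub>p \<phi>) \<rightarrow>\<^sub>p \<chi> \<rightarrow>\<^sub>p \<psi> \<in> \<Gamma>"
      by (rule deductive_taut[OF assms]) (simp add: tautology_def)
    then show ?thesis using deductive_MP[OF assms] that by blast
  qed
  then show "deductive {\<theta>. \<chi> \<rightarrow>\<^sub>p \<theta> \<in> \<Gamma>}" using * assms by (auto simp: deductive_def)
qed

text \<open>Zorn's lemma is applied to the deductive extensions of \<open>\<Gamma>\<close> that omit
  \<open>\<phi>\<close>. In a maximal one, any missing \<open>\<chi>\<close> must imply
  \<open>\<phi>\<close>; if both \<open>\<chi>\<close> and its negation were missing,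
  \<open>\<phi>\<close> would follow by cases.\<close>

lemma Lindenbaum:
  assumes "deductive \<Gamma>" "\<phi> \<notin> \<Gamma>"
  obtains w where "mcs w" "\<Gamma> \<subseteq> w" "\<phi> \<notin> w"
proof -
  let ?A = "{\<Delta>. deductive \<Delta> \<and> \<Gamma> \<subseteq> \<Delta> \<and> \<phi> \<notin> \<Delta>}"
  have "\<exists>U\<in>?A. \<forall>X\<in>C. X \<subseteq> U" if C: "subset.chain ?A C" for C
  \<comment> \<open>The union of the empty chain does not contain \<open>S421\<close>; there
    \<open>\<Gamma>\<close> itself serves as the bound.\<close>
  proof (cases "C = {}")
    case True
    then show ?thesis using assms by auto
  next
    case False
    have CA: "C \<subseteq> ?A" using C by (simp add: subset.chain_def)
    have lin: "X \<subseteq> Y \<or> Y \<subseteq> X" if "X \<in> C" "Y \<in> C" for X Y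
      using C that by (auto simp: subset_chain_def)
    have "\<psi> \<in> \<Union>C" if U: "\<chi> \<rightarrow>\<^sub>p \<psi> \<in> \<Union>C" "\<chi> \<in> \<Union>C" for \<chi> \<psi>
    proof -
      obtain X Y where XY: "X \<in> C" "Y \<in> C" "\<chi> \<rightarrow>\<^sub>p \<psi> \<in> X" "\<chi> \<in> Y" using U by blast
      then have "\<exists>Z\<in>C. \<chi> \<rightarrow>\<^sub>p \<psi> \<in> Z \<and> \<chi> \<in> Z" using lin by blast
      then show ?thesis using CA by (auto dest: deductive_MP)
    qed
    moreover have "S421 \<subseteq> \<Union>C" using False CA by (fastforce simp: deductive_def)
    ultimately have "deductive (\<Union>C)" unfolding deductive_def by blast
    then have "\<Union>C \<in> ?A" using CA False by blast
    then show ?thesis by blast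
  qed
  from subset_Zorn[OF this] obtain w where w: "w \<in> ?A" and max: "\<forall>X\<in>?A. w \<subseteq> X \<longrightarrow> X = w"
    by auto
  have d: "deductive w" using w by simp
  have imp: "\<chi> \<rightarrow>\<^sub>p \<phi> \<in> w" if "\<chi> \<notin> w" for \<chi>
  proof (rule ccontr)
    assume "\<chi> \<rightarrow>\<^sub>p \<phi> \<notin> w"
    then have "{\<theta>. \<chi> \<rightarrow>\<^sub>p \<theta> \<in> w} \<in> ?A" using w deductive_implied[OF d, of \<chi>] by auto
    then show False using max deductive_implied[OF d, of \<chi>] that by blast
  qed
  have "PFls \<notin> w"
  proof
    assume "PFls \<in> w"
    moreover have "PFls \<rightarrow>\<^sub>p \<phi> \<in> w" by (rule deductive_taut[OF d]) (simp add: tautology_def)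
    ultimately show False using w deductive_MP[OF d] by blast
  qed
  moreover have "\<chi> \<in> w \<or> \<not>\<^sub>p \<chi> \<in> w" for \<chi>
  proof (rule ccontr)
    assume "\<not> ?thesis"
    then have "\<chi> \<rightarrow>\<^sub>p \<phi> \<in> w" "\<not>\<^sub>p \<chi> \<rightarrow>\<^sub>p \<phi> \<in> w" using imp by auto
    moreover have "(\<chi> \<rightarrow>\<^sub>p \<phi>) \<rightarrow>\<^sub>p (\<not>\<^sub>p \<chi> \<rightarrow>\<^sub>p \<phi>) \<rightarrow>\<^sub>p \<phi> \<in> w"
      by (rule deductive_taut[OF d]) (auto simp add: tautology_def)
    ultimately show False using w deductive_MP[OF d] by blast
  qed
  ultimately show thesis using that w d by (auto simp: mcs_def)
qed

lemma mcs_S421: "mcs w \<Longrightarrow> \<phi> \<in> S421 \<Longrightarrow> \<phi> \<in> w"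
  by (auto simp: mcs_def deductive_def)

lemma mcs_Imp: 
  assumes "mcs w"
  shows "\<phi> \<rightarrow>\<^sub>p \<psi> \<in> w \<longleftrightarrow> (\<phi> \<in> w \<longrightarrow> \<psi> \<in> w)"
proof -
  have d: "deductive w" using assms by (simp add: mcs_def)
  have "\<not>\<^sub>p \<phi> \<rightarrow>\<^sub>p \<phi> \<rightarrow>\<^sub>p \<psi> \<in> w" "\<psi> \<rightarrow>\<^sub>p \<phi> \<rightarrow>\<^sub>p \<psi> \<in> w"
    by (rule deductive_taut[OF d]; simp add: tautology_def)+
  then show ?thesis using assms deductive_MP[OF d] by (meson mcs_def)
qed

lemma mcs_Fls: "mcs w \<Longrightarrow> PFls \<notin> w"
  by (simp add: mcs_def)

text \<open>For the existence of successors: by K and necessitation the formulas boxed in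
  \<open>w\<close> form a deductive set, and if \<open>\<phi>\<close> is not among them, Lindenbaum
  extends this set to a successor of \<open>w\<close> omitting \<open>\<phi>\<close>.\<close>

lemma mcs_Box:
  assumes "mcs w"
  shows "\<box>\<^sub>p \<phi> \<in> w \<longleftrightarrow> (\<forall>v. mcs v \<and> canon w v \<longrightarrow> \<phi> \<in> v)"
proof
  assume R: "\<forall>v. mcs v \<and> canon w v \<longrightarrow> \<phi> \<in> v"
  have "\<box>\<^sub>p \<psi> \<in> w" if "\<box>\<^sub>p (\<chi> \<rightarrow>\<^sub>p \<psi>) \<in> w" "\<box>\<^sub>p \<chi> \<in> w" for \<chi> \<psi>
    using that mcs_S421[OF assms S421_K] by (metis assms mcs_Imp)
  then have "deductive {\<theta>. \<box>\<^sub>p \<theta> \<in> w}"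
    using assms by (auto simp: deductive_def intro: mcs_S421 S421_Nec)
  then show "\<box>\<^sub>p \<phi> \<in> w"
    using R Lindenbaum[of "{\<theta>. \<box>\<^sub>p \<theta> \<in> w}" \<phi>] by (metis canon_def mem_Collect_eq subsetD)
qed (auto simp: canon_def)

lemma mcs_Dia:
  assumes "mcs w"
  shows "\<diamond>\<^sub>p \<phi> \<in> w \<longleftrightarrow> (\<exists>v. mcs v \<and> canon w v \<and> \<phi> \<in> v)"
  using assms by (auto simp: mcs_Imp mcs_Fls mcs_Box)

lemma canon_refl: "mcs w \<Longrightarrow> canon w w"
  using mcs_S421[OF _ S421_T] by (metis canon_def mcs_Imp)

lemma canon_Box: "mcs w \<Longrightarrow> canon w v \<Longrightarrow> \<box>\<^sub>p \<phi> \<in> w \<Longrightarrow> \<box>\<^sub>p \<phi> \<in> v"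
  using mcs_S421[OF _ S421_4] by (metis canon_def mcs_Imp)

lemma canon_trans: "mcs u \<Longrightarrow> canon u v \<Longrightarrow> canon v w \<Longrightarrow> canon u w"
  using canon_Box by (meson canon_def)

text \<open>The McKinsey axiom makes this set decide every formula, and convergence makes it closed
  under modus ponens: it is the unique final world above \<open>w\<close>.\<close>

definition final :: "pfm set \<Rightarrow> pfm set" where
  "final w = {\<phi>. \<diamond>\<^sub>p \<box>\<^sub>p \<phi> \<in> w}"

text \<open>One inclusion is transitivity of \<open>canon\<close>. For the other, a witness of
  \<diamond>\<box>\<phi> also satisfies \<box>\<box>\<phi>, and convergence turns
  \<diamond>\<box>\<box>\<phi> at \<open>w\<close> into \<box>\<diamond>\<box>\<phi>, which reaches
  \<open>v\<close>.\<close>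

lemma final_upward:
  assumes "mcs w" "mcs v" "canon w v"
  shows "final v = final w"
proof
  show "final v \<subseteq> final w"
    using assms canon_trans[OF assms(1,3)] by (auto simp: final_def mcs_Dia)
  show "final w \<subseteq> final v"
  proof
    fix \<phi> assume "\<phi> \<in> final w"
    then obtain u where u: "mcs u" "canon w u" "\<box>\<^sub>p \<phi> \<in> u"
      using assms by (auto simp: final_def mcs_Dia)
    then have "\<box>\<^sub>p \<box>\<^sub>p \<phi> \<in> u" using mcs_S421[OF _ S421_4] by (metis mcs_Imp)
    then have "\<diamond>\<^sub>p \<box>\<^sub>p \<box>\<^sub>p \<phi> \<in> w" using u assms(1) mcs_Dia by blast
    then have "\<box>\<^sub>p \<diamond>\<^sub>p \<box>\<^sub>p \<phi> \<in> w" using mcs_S421[OF _ S421_dot2] assms(1) by (metis mcs_Imp)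
    then show "\<phi> \<in> final v" using assms(3) by (simp add: final_def canon_def)
  qed
qed

lemma mcs_final:
  assumes w: "mcs w"
  shows "mcs (final w)"
proof -
  have box: "\<phi> \<in> final w" if "\<box>\<^sub>p \<phi> \<in> w" for \<phi>
    using canon_refl[OF w] that w by (auto simp: final_def mcs_Dia)
  have "S421 \<subseteq> final w" using box mcs_S421[OF w] S421_Nec by blast
  moreover have "\<psi> \<in> final w" if f: "\<phi> \<rightarrow>\<^sub>p \<psi> \<in> final w" "\<phi> \<in> final w" for \<phi> \<psi>
  proof -
    obtain v where v: "mcs v" "canon w v" "\<box>\<^sub>p (\<phi> \<rightarrow>\<^sub>p \<psi>) \<in> v"
      using f w by (auto simp: final_def mcs_Dia)
    \<comment> \<open>Since \<open>final\<close> does not change from \<open>w\<close> to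
      \<open>v\<close>, the second premise gets boxed somewhere above \<open>v\<close>, where the
      first is still boxed.\<close>
    then have "\<phi> \<in> final v" using f(2) final_upward[OF w] by simp
    then obtain u where u: "mcs u" "canon v u" "\<box>\<^sub>p \<phi> \<in> u"
      using v by (auto simp: final_def mcs_Dia)
    have "\<box>\<^sub>p (\<phi> \<rightarrow>\<^sub>p \<psi>) \<in> u" using canon_Box v u by blast
    then have "\<box>\<^sub>p \<psi> \<in> u" using u mcs_S421[OF u(1) S421_K] by (metis mcs_Imp)
    then show ?thesis using canon_trans[OF w v(2) u(2)] u w by (auto simp: final_def mcs_Dia)
  qed
  moreover have "PFls \<notin> final w"
  proof
    assume "PFls \<in> final w"
    then obtain v where "mcs v" "\<box>\<^sub>p PFls \<in> v" using w by (auto simp: final_def mcs_Dia)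
    then show False using canon_refl mcs_Fls unfolding canon_def by blast
  qed
  moreover have "\<phi> \<in> final w \<or> \<not>\<^sub>p \<phi> \<in> final w" for \<phi>
  proof (rule ccontr)
    assume n: "\<not> ?thesis"
    \<comment> \<open>No successor boxes \<open>\<phi>\<close>, so each sees its negation: this is
      the premise of the McKinsey axiom for the negation.\<close>
    have "\<diamond>\<^sub>p \<not>\<^sub>p \<phi> \<in> v" if v: "mcs v" "canon w v" for v
    proof -
      have "\<box>\<^sub>p \<phi> \<notin> v" using n v w by (auto simp: final_def mcs_Dia)
      then show ?thesis using v by (auto simp: mcs_Dia mcs_Imp mcs_Box mcs_Fls)
    qed
    then have "\<box>\<^sub>p \<diamond>\<^sub>p \<not>\<^sub>p \<phi> \<in> w" using w mcs_Box by blast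
    then have "\<diamond>\<^sub>p \<box>\<^sub>p \<not>\<^sub>p \<phi> \<in> w" using mcs_S421[OF w S421_dot1] w by (metis mcs_Imp)
    then show False using n by (simp add: final_def)
  qed
  ultimately show ?thesis unfolding mcs_def deductive_def by blast
qed

lemma canon_final:
  assumes "mcs w"
  shows "canon w (final w)"
proof -
  have "\<diamond>\<^sub>p \<box>\<^sub>p \<phi> \<in> w" if "\<box>\<^sub>p \<phi> \<in> w" for \<phi>
    using mcs_Dia[OF assms, of "\<box>\<^sub>p \<phi>"] canon_refl[OF assms] assms that by blast
  then show ?thesis by (simp add: canon_def final_def)
qed

text \<open>From left to right this is T in the final world. From right to left, axiom 4 boxes
  \<box>\<phi> at the very world that witnesses \<diamond>\<box>\<phi>.\<close>

lemma Box_final: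
  assumes "mcs w"
  shows "\<box>\<^sub>p \<phi> \<in> final w \<longleftrightarrow> \<phi> \<in> final w"
proof
  show "\<phi> \<in> final w" if "\<box>\<^sub>p \<phi> \<in> final w"
    using canon_refl[OF mcs_final[OF assms]] that by (simp add: canon_def)
  assume "\<phi> \<in> final w"
  then obtain u where u: "mcs u" "canon w u" "\<box>\<^sub>p \<phi> \<in> u"
    using assms by (auto simp: final_def mcs_Dia)
  then have "\<box>\<^sub>p \<box>\<^sub>p \<phi> \<in> u" using mcs_S421[OF _ S421_4] by (metis mcs_Imp)
  then show "\<box>\<^sub>p \<phi> \<in> final w" using u assms by (auto simp: final_def mcs_Dia)
qed

subsection \<open>Completeness for finite frames with one final point\<close>

fun force :: "'w set \<Rightarrow> ('w \<Rightarrow> 'w \<Rightarrow> bool) \<Rightarrow> (nat \<Rightarrow> 'w \<Rightarrow> bool) \<Rightarrow> 'w \<Rightarrow> pfm \<Rightarrow> bool" where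
  "force F R v w (PVar n) \<longleftrightarrow> v n w"
| "force F R v w PFls \<longleftrightarrow> False"
| "force F R v w (\<phi> \<rightarrow>\<^sub>p \<psi>) \<longleftrightarrow> (force F R v w \<phi> \<longrightarrow> force F R v w \<psi>)"
| "force F R v w (\<box>\<^sub>p \<phi>) \<longleftrightarrow> (\<forall>u\<in>F. R w u \<longrightarrow> force F R v u \<phi>)"

fun subfms :: "pfm \<Rightarrow> pfm set" where
  "subfms (PVar n) = {PVar n}"
| "subfms PFls = {PFls}"
| "subfms (\<phi> \<rightarrow>\<^sub>p \<psi>) = insert (\<phi> \<rightarrow>\<^sub>p \<psi>) (subfms \<phi> \<union> subfms \<psi>)"
| "subfms (\<box>\<^sub>p \<phi>) = insert (\<box>\<^sub>p \<phi>) (subfms \<phi>)"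

lemma finite_subfms: "finite (subfms \<phi>)"
  by (induction \<phi>) auto

lemma subfms_self: "\<phi> \<in> subfms \<phi>"
  by (cases \<phi>) auto

lemma subfms_trans: "\<chi> \<in> subfms \<psi> \<Longrightarrow> subfms \<chi> \<subseteq> subfms \<psi>"
  by (induction \<psi>) auto

text \<open>The point \<open>r\<close> is where a formula is to be refuted; it is not assumed to see
  all of \<open>F\<close>. The final cluster is the single point \<open>t\<close>, as both
  convergence and the McKinsey axiom demand.\<close>

locale topped_frame =
  fixes F :: "'w set" and R :: "'w \<Rightarrow> 'w \<Rightarrow> bool" and r t :: 'w
  assumes finite_F: "finite F" and root: "r \<in> F" and final_in: "t \<in> F"
    and R_refl: "u \<in> F \<Longrightarrow> R u u"
    and R_trans: "R u v \<Longrightarrow> R v w \<Longrightarrow> R u w"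
    and below_final: "u \<in> F \<Longrightarrow> R u t"
    and final_max: "R t u \<Longrightarrow> u = t"

text \<open>Lemmon's filtration of the canonical model, except that the trace \<open>t\<close> of the final world
  is made to see only itself. This is harmless, since \<open>\<box>\<phi>\<close> and \<open>\<phi>\<close> are equivalent in the
  final world.\<close>

theorem S421_complete:
  assumes "\<psi> \<notin> S421"
  obtains F :: "pfm set set" and R r t v where "topped_frame F R r t" "\<not> force F R v r \<psi>"
proof -
  obtain w0 where w0: "mcs w0" "\<psi> \<notin> w0" by (rule Lindenbaum[OF deductive_S421 assms])
  define \<Sigma> where "\<Sigma> = subfms \<psi>"
  define F where "F = {w \<inter> \<Sigma> | w. mcs w \<and> canon w0 w}"
  define t where "t = final w0 \<inter> \<Sigma>"
  define lem where "lem u v \<longleftrightarrow> (\<forall>\<phi>. \<box>\<^sub>p \<phi> \<in> \<Sigma> \<longrightarrow> \<box>\<^sub>p \<phi> \<in> u \<longrightarrow> \<box>\<^sub>p \<phi> \<in> v)" for u v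
  define R where "R u v \<longleftrightarrow> v = t \<or> u \<noteq> t \<and> lem u v" for u v
  define val where "val n u \<longleftrightarrow> PVar n \<in> u" for n and u :: "pfm set"
  have fin: "mcs (final w0)" "canon w0 (final w0)" using w0 mcs_final canon_final by auto
  have "F \<subseteq> Pow \<Sigma>" by (auto simp: F_def)
  then have "finite F" using finite_subfms[of \<psi>] by (metis \<Sigma>_def finite_Pow_iff finite_subset)
  moreover have r: "w0 \<inter> \<Sigma> \<in> F" using w0 canon_refl by (auto simp: F_def)
  moreover have "t \<in> F" using fin by (auto simp: F_def t_def)
  moreover have "R u w" if "R u v" "R v w" for u v w
    using that unfolding R_def lem_def by blast
  moreover have "R u u" for u by (simp add: R_def lem_def)
  moreover have "R u t" "R t u \<Longrightarrow> u = t" for u by (auto simp: R_def)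
  ultimately have frame: "topped_frame F R (w0 \<inter> \<Sigma>) t" unfolding topped_frame_def by metis
  have "force F R val u \<phi> \<longleftrightarrow> \<phi> \<in> u" if "\<phi> \<in> \<Sigma>" "u \<in> F" for \<phi> u
    using that
  proof (induction \<phi> arbitrary: u)
    case (PVar n)
    then show ?case by (simp add: val_def)
  next
    case PFls
    then show ?case using mcs_Fls by (auto simp: F_def)
  next
    case (PImp \<phi> \<chi>)
    obtain w where w: "u = w \<inter> \<Sigma>" "mcs w" using PImp.prems by (auto simp: F_def)
    have "\<phi> \<in> \<Sigma>" "\<chi> \<in> \<Sigma>" using subfms_trans[of "\<phi> \<rightarrow>\<^sub>p \<chi>" \<psi>] PImp.prems subfms_self by (auto simp: \<Sigma>_def)
    then show ?case using PImp w by (auto simp: mcs_Imp)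
  next
    case (PBox \<phi>)
    obtain w where w: "u = w \<inter> \<Sigma>" "mcs w" "canon w0 w" using PBox.prems by (auto simp: F_def)
    have \<phi>: "\<phi> \<in> \<Sigma>" using subfms_trans[of "\<box>\<^sub>p \<phi>" \<psi>] PBox.prems subfms_self by (auto simp: \<Sigma>_def)
    have IH: "force F R val u' \<phi> \<longleftrightarrow> \<phi> \<in> u'" if "u' \<in> F" for u'
      using PBox.IH \<phi> that by blast
    show ?case
    proof (cases "u = t")
      case True
      then have "(\<forall>u'\<in>F. R u u' \<longrightarrow> force F R val u' \<phi>) \<longleftrightarrow> \<phi> \<in> t"
        using IH \<open>t \<in> F\<close> by (auto simp: R_def)
      then show ?thesis using True \<phi> PBox.prems Box_final[OF w0(1)] by (simp add: t_def)
    next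
      case False
      have "\<phi> \<in> u'" if b: "\<box>\<^sub>p \<phi> \<in> u" and u': "u' \<in> F" "R u u'" for u'
      proof (cases "u' = t")
        case True
        \<comment> \<open>All worlds above \<open>w0\<close> share one final world, so what is boxed
          in \<open>w\<close> is true there.\<close>
        have "final w = final w0" using final_upward w w0 by blast
        then have "\<phi> \<in> final w0" using canon_final[OF w(2)] b w(1) by (auto simp: canon_def)
        then show ?thesis using True \<phi> by (simp add: t_def)
      next
        case False
        obtain w' where w': "u' = w' \<inter> \<Sigma>" "mcs w'" using u' by (auto simp: F_def)
        have "\<box>\<^sub>p \<phi> \<in> u'" using False u' b PBox.prems by (auto simp: R_def lem_def)
        then show ?thesis using w' canon_refl[OF w'(2)] \<phi> by (auto simp: canon_def)
      qed
      moreover have "\<exists>u'\<in>F. R u u' \<and> \<phi> \<notin> u'" if b: "\<box>\<^sub>p \<phi> \<notin> u"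
      proof -
        have "\<box>\<^sub>p \<phi> \<notin> w" using b w PBox.prems by simp
        then obtain v where v: "mcs v" "canon w v" "\<phi> \<notin> v" using w mcs_Box by blast
        have "v \<inter> \<Sigma> \<in> F" using v canon_trans[OF w0(1) w(3) v(2)] by (auto simp: F_def)
        moreover have "R u (v \<inter> \<Sigma>)" using False w canon_Box[OF w(2) v(2)]
          by (auto simp: R_def lem_def)
        ultimately show ?thesis using v by blast
      qed
      ultimately show ?thesis using IH by auto
    qed
  qed
  then have "\<not> force F R val (w0 \<inter> \<Sigma>) \<psi>" using r w0 subfms_self by (auto simp: \<Sigma>_def)
  then show thesis using that frame by blast
qed

subsection \<open>Soundness\<close>

lemma condensation_id: "condensation U U id"
  by (simp add: condensation_def)

lemma condensation_comp:
  "condensation U V f \<Longrightarrow> condensation V W g \<Longrightarrow> condensation U W (g \<circ> f)"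
  unfolding condensation_def by (metis comp_apply image_comp)

lemma lo_point: "lo {(a, a)}"
  by (auto simp: lo_def order_on_defs Field_def refl_on_def trans_def antisym_def total_on_def)

lemma condensation_point: "lo U \<Longrightarrow> condensation U {(a, a)} (\<lambda>_. a)"
  by (auto simp: lo_def condensation_def Field_def)

text \<open>A condensation out of one point is an isomorphism, so at the one-point world both
  modalities are vacuous.\<close>

lemma sat_point:
  fixes V :: "'a rel"
  assumes "lo V" "condensation {(a, a)} V f"
  shows "sat V (f \<circ> (\<lambda>_. a)) (f \<circ> (\<lambda>_. a)) \<phi> \<longleftrightarrow> sat {(a, a)} (\<lambda>_. a) (\<lambda>_. a) \<phi>"
proof -
  have "oiso {(a, a)} V f"
    using assms(2) by (auto simp: condensation_def oiso_def bij_betw_def Field_def)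
  from sat_oiso[OF lo_point assms(1) this, of \<phi> "\<lambda>_. a" "\<lambda>_. a"] show ?thesis
    by (simp add: Field_def)
qed

lemma inst_psubst: "inst \<sigma> (psubst \<tau> \<phi>) = inst (\<lambda>n. inst \<sigma> (\<tau> n)) \<phi>"
  by (induction \<phi>) auto

lemma sat_inst_peval: "sat U \<iota> \<nu> (inst \<sigma> \<phi>) \<longleftrightarrow> peval (\<lambda>\<chi>. sat U \<iota> \<nu> (inst \<sigma> \<chi>)) \<phi>"
  by (induction \<phi>) auto

text \<open>The last two axioms hold because of the one-point order: a necessary formula is true
  there, and a formula true there is possible at every world. After the collapse all constants and
  variables denote \<open>a\<close>, so the truth value no longer depends on where the collapse
  started.\<close>

lemma sat_S421_axioms:
  fixes U :: "'a rel" and \<iota> :: "'c \<Rightarrow> 'a"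
  assumes U: "lo U"
  shows "sat U \<iota> \<nu> (Imp (Box \<phi>) \<phi>)"
    and "sat U \<iota> \<nu> (Imp (Box \<phi>) (Box (Box \<phi>)))"
    and "sat U \<iota> \<nu> (Imp (Dia (Box \<phi>)) (Box (Dia \<phi>)))"
    and "sat U \<iota> \<nu> (Imp (Box (Dia \<phi>)) (Dia (Box \<phi>)))"
proof -
  obtain a where a: "a \<in> Field U" using U by (auto simp: lo_def)
  let ?P = "{(a, a)}" and ?c = "\<lambda>_. a"
  have to_point: "sat ?P ?c ?c \<chi>" if "lo V" "sat V \<iota>' \<nu>' (Box \<chi>)" for V :: "'a rel" and \<iota>' :: "'c \<Rightarrow> 'a" and \<nu>' \<chi>
    using that lo_point[of a] condensation_point[of V a] by (auto simp: comp_def)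
  have from_point: "sat V \<iota>' \<nu>' (Dia \<chi>)" if "lo V" "sat ?P ?c ?c \<chi>" for V :: "'a rel" and \<iota>' :: "'c \<Rightarrow> 'a" and \<nu>' \<chi>
    unfolding sat_Dia using that lo_point[of a] condensation_point[of V a] by (force simp: comp_def)
  show "sat U \<iota> \<nu> (Imp (Box \<phi>) \<phi>)"
    using U condensation_id[of U] by (auto dest!: spec[of _ U] spec[of _ id])
  show "sat U \<iota> \<nu> (Imp (Box \<phi>) (Box (Box \<phi>)))"
    unfolding sat.simps(4,6)
  proof (intro impI allI, elim conjE)
    fix V W :: "'a rel" and f g
    assume h: "\<forall>(V :: 'a rel) f. lo V \<and> condensation U V f \<longrightarrow> sat V (f \<circ> \<iota>) (f \<circ> \<nu>) \<phi>"
      and "condensation U V f" "lo W" "condensation V W g"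
    then have "sat W ((g \<circ> f) \<circ> \<iota>) ((g \<circ> f) \<circ> \<nu>) \<phi>"
      using h[rule_format, of W "g \<circ> f"] condensation_comp[of U V f W g] by blast
    then show "sat W (g \<circ> (f \<circ> \<iota>)) (g \<circ> (f \<circ> \<nu>)) \<phi>" by (simp only: comp_assoc)
  qed
  show "sat U \<iota> \<nu> (Imp (Dia (Box \<phi>)) (Box (Dia \<phi>)))"
  proof (subst sat.simps(4), rule impI)
    assume "sat U \<iota> \<nu> (Dia (Box \<phi>))"
    then have "sat ?P ?c ?c \<phi>" unfolding sat_Dia using to_point by blast
    then show "sat U \<iota> \<nu> (Box (Dia \<phi>))" unfolding sat.simps(6) using from_point by blast
  qed
  show "sat U \<iota> \<nu> (Imp (Box (Dia \<phi>)) (Dia (Box \<phi>)))"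
  proof (subst sat.simps(4), rule impI)
    assume "sat U \<iota> \<nu> (Box (Dia \<phi>))"
    then have "sat ?P ?c ?c (Dia \<phi>)" using to_point[OF U] by blast
    then have "sat ?P ?c ?c \<phi>" unfolding sat_Dia using sat_point by metis
    then have "sat ?P ?c ?c (Box \<phi>)" unfolding sat.simps(6) using sat_point by metis
    then show "sat U \<iota> \<nu> (Dia (Box \<phi>))" using from_point[OF U] by blast
  qed
qed

text \<open>The induction generalises over the world and both interpretations because necessitation
  passes to the targets of condensations, and over \<open>\<sigma>\<close> because of the
  substitution rule.\<close>

lemma S421_sound:
  fixes U :: "'a rel"
  assumes "\<psi> \<in> S421" "lo U"
  shows "sat U \<iota> \<nu> (inst \<sigma> \<psi>)"
  using assms unfolding S421_def Let_def
proof (induction arbitrary: U \<iota> \<nu> \<sigma> rule: normal_logic.induct)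
  case (taut \<phi>)
  then show ?case by (subst sat_inst_peval) (simp add: tautology_def)
next
  case (ax \<phi>)
  then show ?case using sat_S421_axioms[OF ax(2), of \<iota> \<nu> "\<sigma> 0"]
    by (auto simp del: sat.simps)
next
  case (Sub \<phi> \<tau>)
  then show ?case by (simp add: inst_psubst)
qed auto

corollary S421_subset_Val: "lo W \<Longrightarrow> S421 \<subseteq> Val W (lang W)"
  by (auto simp: Val_def holds_def S421_sound)

subsection \<open>Labelling a frame by pressed buttons and a dial\<close>

context topped_frame
begin

definition chain :: "'w set \<Rightarrow> bool" where
  "chain K \<longleftrightarrow> (\<forall>u\<in>K. \<forall>v\<in>K. R u v \<or> R v u)"

text \<open>For a nonempty finite chain in \<open>F\<close> this is the whole cluster in
  \<open>F\<close> of its greatest members; members of that cluster outside \<open>K\<close> count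
  as well.\<close>

definition heads :: "'w set \<Rightarrow> 'w set" where
  "heads K = {u \<in> F. (\<forall>v\<in>K. R v u) \<and> (\<exists>v\<in>K. R u v)}"

text \<open>The pressed buttons \<open>P\<close> select a cluster and the dial \<open>d\<close> a point in it. Once \<open>live\<close> is
  lost, or two incomparable buttons are pressed, the label is final.\<close>

definition label :: "bool \<Rightarrow> 'w set \<Rightarrow> 'w \<Rightarrow> 'w" where
  "label live P d =
     (if live \<and> chain (insert r P)
      then if d \<in> heads (insert r P) then d else (SOME u. u \<in> heads (insert r P))
      else t)"

lemma heads_nonempty:
  assumes "K \<subseteq> F" "K \<noteq> {}" "chain K"
  shows "heads K \<noteq> {}"
proof -
  have "finite K" using assms finite_F finite_subset by blast
  then have "\<exists>u\<in>K. \<forall>v\<in>K. R v u" using assms(2,1,3)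
  proof (induction K rule: finite_ne_induct)
    case (singleton x)
    then show ?case using R_refl by auto
  next
    case (insert x K)
    then obtain u where u: "u \<in> K" "\<forall>v\<in>K. R v u" by (auto simp: chain_def)
    have "R x u \<or> R u x" using insert.prems u by (auto simp: chain_def)
    then show ?case
    proof
      assume "R x u"
      then show ?thesis using u by auto
    next
      assume "R u x"
      then have "\<forall>v\<in>insert x K. R v x" using u R_trans insert.prems R_refl by blast
      then show ?thesis by auto
    qed
  qed
  then show ?thesis using assms(1) unfolding heads_def by blast
qed

lemma label_live:
  assumes "P \<subseteq> F" "chain (insert r P)"
  shows "label True P d \<in> heads (insert r P)"
  using heads_nonempty[of "insert r P"] assms root
  by (auto simp: label_def some_in_eq)

lemma label_in: "P \<subseteq> F \<Longrightarrow> label live P d \<in> F"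
  using label_live[of P d] final_in by (cases live; cases "chain (insert r P)") (auto simp: label_def heads_def)

text \<open>A head of the larger set lies above everything pressed earlier, hence above every
  earlier head, wherever the dial stands; in the remaining case the new label is \<open>t\<close>,
  which everything sees. This is the forth condition of the bounded morphism.\<close>

lemma label_mono:
  assumes "P \<subseteq> P'" "P' \<subseteq> F" "live' \<Longrightarrow> live"
  shows "R (label live P d) (label live' P' d')"
proof (cases "live' \<and> chain (insert r P')")
  case True
  have ch: "chain (insert r P)" using True assms(1) unfolding chain_def by blast
  have 1: "label True P d \<in> heads (insert r P)" using label_live ch assms by blast
  have 2: "label True P' d' \<in> heads (insert r P')" using label_live True assms by blast
  obtain v where "v \<in> insert r P" "R (label True P d) v" using 1 by (auto simp: heads_def)
  moreover have "R v (label True P' d')" using 2 assms(1) calculation(1) unfolding heads_def by blast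
  ultimately have "R (label True P d) (label True P' d')" using R_trans by blast
  then show ?thesis using True assms(3) by simp
next
  case False
  then have "label live' P' d' = t" by (auto simp: label_def)
  then show ?thesis using label_in[of P live d] assms below_final by auto
qed

text \<open>A point above the current head lies above all pressed points, so pressing its own button
  keeps the chain and makes it a head, and the dial can then select it. This is the back condition
  as long as the label is not dead.\<close>

lemma label_step:
  assumes "P \<subseteq> F" "live" "chain (insert r P)" "v \<in> F" "R (label live P d) v"
  shows "label True (insert v P) v = v"
proof -
  let ?u = "label live P d"
  have "?u \<in> heads (insert r P)" using label_live assms by auto
  then have b: "\<forall>k\<in>insert r P. R k v" using assms(5) R_trans unfolding heads_def by blast
  then have "chain (insert r (insert v P))" using assms(3) R_refl[OF assms(4)]
    unfolding chain_def by blast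
  moreover have "v \<in> heads (insert r (insert v P))"
    using b R_refl[OF assms(4)] assms(4) by (auto simp: heads_def)
  ultimately show ?thesis by (simp add: label_def)
qed

lemma label_dead:
  assumes "\<not> (live \<and> chain (insert r P))"
  shows "label live P d = t"
  using assms by (auto simp: label_def)

lemma label_root: "label True {} r = r"
  using root R_refl by (simp add: label_def chain_def heads_def)

end

subsection \<open>Expressible properties\<close>

abbreviation And :: "'c fm \<Rightarrow> 'c fm \<Rightarrow> 'c fm" where "And \<phi> \<psi> \<equiv> Neg (Imp \<phi> (Neg \<psi>))"

text \<open>Shannon expansion at the last sentence: \<open>Q\<close> is split according to its truth
  value. The sentence \<open>\<theta>\<close> is uniform in the world and the interpretations, so it
  can serve as a substitution instance.\<close>

lemma boolean_combination:
  fixes \<chi> :: "nat \<Rightarrow> 'c fm"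
  assumes "\<forall>i<n. fv (\<chi> i) = {} \<and> set_fm (\<chi> i) \<subseteq> C"
  shows "\<exists>\<theta>. fv \<theta> = {} \<and> set_fm \<theta> \<subseteq> C \<and>
     (\<forall>(U :: 'a rel) \<iota> \<nu>. sat U \<iota> \<nu> \<theta> \<longleftrightarrow> Q {i. i < n \<and> sat U \<iota> \<nu> (\<chi> i)})"
  using assms
proof (induction n arbitrary: Q)
  case 0
  show ?case by (rule exI[of _ "if Q {} then Neg Fls else Fls"]) simp
next
  case (Suc n)
  obtain \<theta>1 where 1: "fv \<theta>1 = {}" "set_fm \<theta>1 \<subseteq> C"
    "\<And>(U :: 'a rel) \<iota> \<nu>. sat U \<iota> \<nu> \<theta>1 \<longleftrightarrow> Q (insert n {i. i < n \<and> sat U \<iota> \<nu> (\<chi> i)})"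
    using Suc.IH[of "\<lambda>S. Q (insert n S)"] Suc.prems by auto
  obtain \<theta>0 where 0: "fv \<theta>0 = {}" "set_fm \<theta>0 \<subseteq> C"
    "\<And>(U :: 'a rel) \<iota> \<nu>. sat U \<iota> \<nu> \<theta>0 \<longleftrightarrow> Q {i. i < n \<and> sat U \<iota> \<nu> (\<chi> i)}"
    using Suc.IH[of Q] Suc.prems by auto
  have S: "{i. i < Suc n \<and> sat U \<iota> \<nu> (\<chi> i)} =
      (if sat U \<iota> \<nu> (\<chi> n) then insert n {i. i < n \<and> sat U \<iota> \<nu> (\<chi> i)}
       else {i. i < n \<and> sat U \<iota> \<nu> (\<chi> i)})" for U :: "'a rel" and \<iota> \<nu>
    by (auto simp: less_Suc_eq)
  show ?case
    by (rule exI[of _ "And (Imp (\<chi> n) \<theta>1) (Imp (Neg (\<chi> n)) \<theta>0)"])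
      (use 0 1 Suc.prems in \<open>simp add: S\<close>)
qed

section \<open>Covers, density and the formulas defining them\<close>

definition covers :: "'a rel \<Rightarrow> 'a \<Rightarrow> 'a \<Rightarrow> bool" where
  "covers V x y \<longleftrightarrow> (x, y) \<in> V \<and> x \<noteq> y \<and> (\<forall>z. (x, z) \<in> V \<longrightarrow> (z, y) \<in> V \<longrightarrow> z \<noteq> x \<longrightarrow> z = y)"

text \<open>In a linear order a cover is unique if it exists, so the possible lengths form an
  initial segment of the naturals whose end is the dial position.\<close>

primrec covering_chain :: "'a rel \<Rightarrow> nat \<Rightarrow> 'a \<Rightarrow> bool" where
  "covering_chain V 0 x \<longleftrightarrow> True"
| "covering_chain V (Suc j) x \<longleftrightarrow> (\<exists>y. covers V x y \<and> covering_chain V j y)"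

text \<open>The first conjunct excludes a greatest element \<open>c\<close>, whose upper part would
  be dense vacuously.\<close>

definition dense_above :: "'a rel \<Rightarrow> 'a \<Rightarrow> bool" where
  "dense_above V c \<longleftrightarrow> (\<exists>y. (c, y) \<in> V \<and> c \<noteq> y) \<and>
     (\<forall>x y. (c, x) \<in> V \<longrightarrow> (x, y) \<in> V \<longrightarrow> x \<noteq> y \<longrightarrow>
        (\<exists>z. (x, z) \<in> V \<and> (z, y) \<in> V \<and> z \<noteq> x \<and> z \<noteq> y))"

text \<open>For the upper part at \<open>c\<close> this amounts to being non-scattered.\<close>

definition live :: "'a rel \<Rightarrow> 'a \<Rightarrow> bool" where
  "live V c \<longleftrightarrow> (\<exists>(V' :: 'a rel) f. lo V' \<and> condensation V V' f \<and> dense_above V' (f c))"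

definition covers_fm :: "'c trm \<Rightarrow> 'c trm \<Rightarrow> nat \<Rightarrow> 'c fm" where
  "covers_fm s u n = And (Le s u) (And (Neg (Eq s u))
     (All n (Imp (Le s (Var n)) (Imp (Le (Var n) u) (Imp (Neg (Eq (Var n) s)) (Eq (Var n) u))))))"

text \<open>The index \<open>n\<close> has to lie above all variables of \<open>s\<close>; it names
  the next link, and \<open>Suc n\<close> is free for the quantifier inside \<open>covers_fm\<close>
  and for the recursive call.\<close>

primrec covering_chain_fm :: "nat \<Rightarrow> 'c trm \<Rightarrow> nat \<Rightarrow> 'c fm" where
  "covering_chain_fm 0 s n = Neg Fls"
| "covering_chain_fm (Suc j) s n =
     Ex n (And (covers_fm s (Var n) (Suc n)) (covering_chain_fm j (Var n) (Suc n)))"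

definition dense_above_fm :: "'c \<Rightarrow> 'c fm" where
  "dense_above_fm c = And (Ex 0 (And (Le (Const c) (Var 0)) (Neg (Eq (Const c) (Var 0)))))
     (All 0 (All 1 (Imp (Le (Const c) (Var 0)) (Imp (Le (Var 0) (Var 1))
       (Imp (Neg (Eq (Var 0) (Var 1)))
         (Ex 2 (And (Le (Var 0) (Var 2)) (And (Le (Var 2) (Var 1))
           (And (Neg (Eq (Var 2) (Var 0))) (Neg (Eq (Var 2) (Var 1))))))))))))"

lemma tval_upd: "n \<notin> tfv s \<Longrightarrow> tval \<iota> (\<nu>(n := x)) s = tval \<iota> \<nu> s"
  by (cases s) auto

lemma sat_covers_fm:
  assumes "n \<notin> tfv s" "n \<notin> tfv u"
  shows "sat V \<iota> \<nu> (covers_fm s u n) \<longleftrightarrow> covers V (tval \<iota> \<nu> s) (tval \<iota> \<nu> u)"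
  using assms by (auto simp: covers_fm_def covers_def tval_upd Field_def)

lemma sat_covering_chain_fm:
  assumes "tfv s \<subseteq> {..<n}"
  shows "sat V \<iota> \<nu> (covering_chain_fm j s n) \<longleftrightarrow> covering_chain V j (tval \<iota> \<nu> s)"
  using assms
proof (induction j arbitrary: s n \<nu>)
  case (Suc j)
  have IH: "sat V \<iota> (\<nu>(n := x)) (covering_chain_fm j (Var n) (Suc n)) \<longleftrightarrow> covering_chain V j x" for x
    using Suc.IH[of "Var n" "Suc n"] by simp
  have s: "n \<notin> tfv s" "Suc n \<notin> tfv s" using Suc.prems by auto
  have C: "sat V \<iota> (\<nu>(n := x)) (covers_fm s (Var n) (Suc n)) \<longleftrightarrow> covers V (tval \<iota> \<nu> s) x" for x
    using sat_covers_fm[of "Suc n" s "Var n" V \<iota> "\<nu>(n := x)"] s by (simp add: tval_upd)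
  have "covers V x y \<Longrightarrow> y \<in> Field V" for x y by (auto simp: covers_def Field_def)
  then show ?case by (auto simp: IH C)
qed simp

lemma covering_chain_fm_lang:
  "fv (covering_chain_fm j s n) \<subseteq> tfv s \<and> set_fm (covering_chain_fm j s n) \<subseteq> set_trm s"
  by (induction j arbitrary: s n) (fastforce simp: covers_fm_def)+

lemma sat_dense_above_fm: "sat V \<iota> \<nu> (dense_above_fm c) \<longleftrightarrow> dense_above V (\<iota> c)"
proof -
  have F: "x \<in> Field V" "y \<in> Field V" if "(x, y) \<in> V" for x y
    using that by (auto simp: Field_def)
  have "sat V \<iota> \<nu> (dense_above_fm c) \<longleftrightarrow> (\<exists>y\<in>Field V. (\<iota> c, y) \<in> V \<and> \<iota> c \<noteq> y) \<and>
     (\<forall>x\<in>Field V. \<forall>y\<in>Field V. (\<iota> c, x) \<in> V \<longrightarrow> (x, y) \<in> V \<longrightarrow> x = y \<or>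
        (\<exists>z\<in>Field V. (x, z) \<in> V \<and> (z, y) \<in> V \<and> z \<noteq> x \<and> z \<noteq> y))"
    by (simp add: dense_above_fm_def)
  also have "\<dots> \<longleftrightarrow> dense_above V (\<iota> c)"
    unfolding dense_above_def using F by meson
  finally show ?thesis .
qed

lemma sat_live_fm: "sat V \<iota> \<nu> (Dia (dense_above_fm c)) \<longleftrightarrow> live V (\<iota> c)"
  unfolding sat_Dia live_def by (simp add: sat_dense_above_fm)

subsection \<open>Condensations of linear orders\<close>

lemma lo_facts:
  assumes "lo V"
  shows lo_refl: "x \<in> Field V \<Longrightarrow> (x, x) \<in> V"
    and lo_trans: "(x, y) \<in> V \<Longrightarrow> (y, z) \<in> V \<Longrightarrow> (x, z) \<in> V"
    and lo_antisym: "(x, y) \<in> V \<Longrightarrow> (y, x) \<in> V \<Longrightarrow> x = y"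
    and lo_total: "x \<in> Field V \<Longrightarrow> y \<in> Field V \<Longrightarrow> (x, y) \<in> V \<or> (y, x) \<in> V"
proof -
  have lin: "Linear_order V" using assms by (simp add: lo_def)
  show r: "(x, x) \<in> V" if "x \<in> Field V" for x
    using lin that by (auto simp: order_on_defs refl_on_def)
  show "(x, y) \<in> V \<Longrightarrow> (y, z) \<in> V \<Longrightarrow> (x, z) \<in> V" using lin by (meson order_on_defs transD)
  show "(x, y) \<in> V \<Longrightarrow> (y, x) \<in> V \<Longrightarrow> x = y" using lin by (meson order_on_defs antisymD)
  show "x \<in> Field V \<Longrightarrow> y \<in> Field V \<Longrightarrow> (x, y) \<in> V \<or> (y, x) \<in> V"
    using lin r by (metis order_on_defs(3) total_on_def)
qed

lemma rel_Field: "(x, y) \<in> V \<Longrightarrow> x \<in> Field V" "(x, y) \<in> V \<Longrightarrow> y \<in> Field V"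
  by (auto simp: Field_def)

text \<open>Collapsing inside \<open>V\<close> keeps the type of worlds and leaves fixed points
  literally in place, so collapses can be composed without renaming parameters.\<close>

lemma condensation_self_map:
  assumes V: "lo V" and mono: "\<And>x y. (x, y) \<in> V \<Longrightarrow> (g x, g y) \<in> V"
  defines "V' \<equiv> Restr V (g ` Field V)"
  shows "lo V'" "condensation V V' g" "Field V' = g ` Field V"
proof -
  have sub: "g ` Field V \<subseteq> Field V"
    using mono lo_refl[OF V] rel_Field by fast
  have lin: "Linear_order V" and "Refl V" using V by (auto simp: lo_def order_on_defs)
  then show F: "Field V' = g ` Field V" unfolding V'_def using sub by (simp add: Refl_Field_Restr2)
  have "Linear_order V'" unfolding V'_def using lin by (rule Linear_order_Restr)
  then show "lo V'" using F V by (simp add: lo_def)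
  show "condensation V V' g" using mono F rel_Field unfolding condensation_def V'_def by fast
qed

text \<open>The upper parts at \<open>c\<close> coincide as orders on the same points. Density above
  \<open>c\<close> and the covering chains from \<open>c\<close> depend on nothing else.\<close>

definition agree_above :: "'a rel \<Rightarrow> 'a rel \<Rightarrow> 'a \<Rightarrow> bool" where
  "agree_above V V' c \<longleftrightarrow>
     (\<forall>x. (c, x) \<in> V' \<longleftrightarrow> (c, x) \<in> V) \<and> (\<forall>x y. (c, x) \<in> V \<longrightarrow> ((x, y) \<in> V' \<longleftrightarrow> (x, y) \<in> V))"

lemma agree_above_upward:
  "lo V \<Longrightarrow> agree_above V V' c \<Longrightarrow> (c, d) \<in> V \<Longrightarrow> agree_above V V' d"
  unfolding agree_above_def using lo_trans by metis

lemma agree_above_Restr: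
  assumes "lo V" "\<And>x. (c, x) \<in> V \<Longrightarrow> g x = x"
  shows "agree_above V (Restr V (g ` Field V)) c"
proof -
  have "x \<in> g ` Field V" if "(c, x) \<in> V" for x
    using assms(2)[OF that] rel_Field(2)[OF that] by force
  moreover have "c \<in> g ` Field V" if "(c, x) \<in> V" for x
    using calculation lo_refl[OF assms(1)] rel_Field that by metis
  ultimately show ?thesis
    unfolding agree_above_def using lo_trans[OF assms(1)] by blast
qed

lemma dense_above_agree:
  assumes "agree_above V V' c" "dense_above V c" "lo V"
  shows "dense_above V' c"
proof -
  have 1: "(c, x) \<in> V' \<longleftrightarrow> (c, x) \<in> V" for x using assms by (auto simp: agree_above_def)
  have 2: "(c, x) \<in> V \<Longrightarrow> (x, y) \<in> V' \<longleftrightarrow> (x, y) \<in> V" for x y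
    using assms by (auto simp: agree_above_def)
  have "\<exists>z. (x, z) \<in> V' \<and> (z, y) \<in> V' \<and> z \<noteq> x \<and> z \<noteq> y"
    if xy: "(c, x) \<in> V'" "(x, y) \<in> V'" "x \<noteq> y" for x y
  proof -
    obtain z where z: "(x, z) \<in> V" "(z, y) \<in> V" "z \<noteq> x" "z \<noteq> y"
      using assms(2) xy 1 2 unfolding dense_above_def by blast
    moreover have "(c, z) \<in> V" using lo_trans[OF assms(3)] z xy 1 by blast
    ultimately show ?thesis using xy 1 2 by blast
  qed
  then show ?thesis using assms(2) 1 unfolding dense_above_def by blast
qed

lemma covers_agree:
  assumes "agree_above V V' c" "lo V"
  shows "covers V' c y \<longleftrightarrow> covers V c y"
  using assms unfolding agree_above_def covers_def by blast

lemma covering_chain_agree: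
  assumes "agree_above V V' c" "lo V"
  shows "covering_chain V' j c \<longleftrightarrow> covering_chain V j c"
  using assms
proof (induction j arbitrary: c)
  case (Suc j)
  have "covering_chain V' j y \<longleftrightarrow> covering_chain V j y" if "covers V c y" for y
    using Suc.IH[OF agree_above_upward[OF Suc.prems(2,1)]] that Suc.prems by (auto simp: covers_def)
  then show ?case using covers_agree[OF Suc.prems] by auto
qed simp

section \<open>Liveness, the dial and the buttons under condensations\<close>

lemma dense_above_upward:
  assumes "lo V" "dense_above V c" "(c, z) \<in> V" "(z, y) \<in> V" "z \<noteq> y"
  shows "dense_above V z"
  using assms(2-5) lo_trans[OF assms(1)] unfolding dense_above_def by meson

lemma dense_above_Field: "dense_above V c \<Longrightarrow> c \<in> Field V"
  by (auto simp: dense_above_def Field_def)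

text \<open>Collapse everything up to \<open>e\<close> onto \<open>e\<close>: the point
  \<open>c\<close> lands there, and the dense part above \<open>e\<close> is untouched.\<close>

lemma live_if_dense_above:
  assumes V: "lo V" and e: "(c, e) \<in> V" "dense_above V e"
  shows "live V c"
proof -
  define g where "g x = (if (x, e) \<in> V then e else x)" for x
  have eF: "e \<in> Field V" using e rel_Field by fast
  have "(g x, g y) \<in> V" if xy: "(x, y) \<in> V" for x y
  proof (cases "(y, e) \<in> V")
    case True
    then have "(x, e) \<in> V" using xy lo_trans[OF V] by blast
    then show ?thesis using True lo_refl[OF V eF] by (simp add: g_def)
  next
    case False
    then have "(e, y) \<in> V" using xy lo_total[OF V eF] rel_Field(2)[OF xy] by blast
    then show ?thesis using False xy by (simp add: g_def)
  qed
  note c = condensation_self_map[of V g, OF V this]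
  have "g x = x" if "(e, x) \<in> V" for x using that lo_antisym[OF V] by (auto simp: g_def)
  from dense_above_agree[OF agree_above_Restr[OF V this] e(2) V]
  have "dense_above (Restr V (g ` Field V)) (g c)" using e by (simp add: g_def)
  then show ?thesis unfolding live_def using c by blast
qed

text \<open>Condensations compose; hence liveness, once lost, never returns.\<close>

lemma live_upstream:
  fixes V V' :: "'a rel"
  assumes "condensation V V' f" "live V' (f c)"
  shows "live V c"
proof -
  obtain W :: "'a rel" and h where W: "lo W" "condensation V' W h" "dense_above W ((h \<circ> f) c)"
    using assms(2) unfolding live_def by auto
  then show ?thesis unfolding live_def using condensation_comp[OF assms(1) W(2)] by blast
qed

text \<open>A witness of liveness can be chosen to leave everything up to \<open>c\<close> untouched: collapse
  above \<open>c\<close> only, using a section of the given condensation.\<close>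

lemma live_normalise:
  fixes V :: "'a rel"
  assumes V: "lo V" and c: "c \<in> Field V" and live: "live V c"
  obtains V' p where "lo V'" "condensation V V' p" "\<And>x. (x, c) \<in> V \<Longrightarrow> p x = x" "dense_above V' c"
proof -
  obtain W :: "'a rel" and f where W: "lo W" "condensation V W f" "dense_above W (f c)"
    using live unfolding live_def by blast
  have mono: "(f x, f y) \<in> W" if "(x, y) \<in> V" for x y using that W by (auto simp: condensation_def)
  have im: "f ` Field V = Field W" using W by (simp add: condensation_def)
  \<comment> \<open>A section of a monotone map between linear orders is again monotone. Its value
    at \<open>f c\<close> is prescribed so that the map \<open>p\<close> fixes \<open>c\<close> and
    its two halves fit together.\<close>
  define s where "s d = (if d = f c then c else inv_into (Field V) f d)" for d
  have s: "f (s d) = d" "s d \<in> Field V" if "d \<in> Field W" for d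
    using that im c by (auto simp: s_def f_inv_into_f inv_into_into)
  have s_mono: "(s d, s d') \<in> V" if "(d, d') \<in> W" for d d'
  proof -
    have F: "d \<in> Field W" "d' \<in> Field W" using rel_Field[OF that] by auto
    then have "(s d, s d') \<in> V \<or> (s d', s d) \<in> V" using lo_total[OF V] s by blast
    moreover have "(s d, s d') \<in> V" if "(s d', s d) \<in> V"
    proof -
      have "(d', d) \<in> W" using mono[OF that] F by (simp add: s)
      then have "d = d'" using \<open>(d, d') \<in> W\<close> lo_antisym[OF W(1)] by blast
      then show ?thesis using s F lo_refl[OF V] by blast
    qed
    ultimately show ?thesis by blast
  qed
  have sc: "s (f c) = c" by (simp add: s_def)
  define p where "p x = (if (x, c) \<in> V then x else s (f x))" for x
  have p_above: "p x = s (f x)" if "(c, x) \<in> V" for x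
    using that lo_antisym[OF V, of x c] sc by (auto simp: p_def)
  have above: "(c, x) \<in> V" if "x \<in> Field V" "(x, c) \<notin> V" for x using lo_total[OF V] c that by blast
  have p_mono: "(p x, p y) \<in> V" if xy: "(x, y) \<in> V" for x y
  proof (cases "(x, c) \<in> V")
    case x: True
    show ?thesis
    proof (cases "(y, c) \<in> V")
      case True
      then show ?thesis using xy x by (simp add: p_def)
    next
      case False
      then have cy: "(c, y) \<in> V" using above rel_Field(2)[OF xy] by blast
      then have "(c, p y) \<in> V" using s_mono[OF mono[OF cy]] p_above[OF cy] sc by simp
      then have "(x, p y) \<in> V" using lo_trans[OF V x] by blast
      then show ?thesis using x by (simp add: p_def[of x])
    qed
  next
    case False
    then have "(c, x) \<in> V" using above rel_Field(1)[OF xy] by blast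
    moreover from this have "(c, y) \<in> V" using xy lo_trans[OF V] by blast
    ultimately show ?thesis using s_mono[OF mono[OF xy]] p_above by simp
  qed
  define V' where "V' = Restr V (p ` Field V)"
  note C = condensation_self_map[of V p, OF V p_mono, folded V'_def]
  have p_le: "p x = x" if "(x, c) \<in> V" for x using that by (simp add: p_def)
  have pc: "p c = c" using p_le lo_refl[OF V c] by blast
  have rep: "\<exists>x. (c, x) \<in> V \<and> u = p x" if u: "(c, u) \<in> V'" for u
  proof -
    obtain x where x: "x \<in> Field V" "u = p x" using rel_Field(2)[OF u] C(3) by auto
    show ?thesis
    proof (cases "(x, c) \<in> V")
      case True
      then have "u = c" using u x p_le lo_antisym[OF V] by (auto simp: V'_def)
      then show ?thesis using pc lo_refl[OF V c] by metis
    next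
      case False
      then show ?thesis using above x by blast
    qed
  qed
  have inV': "(p x, p y) \<in> V'" if "(x, y) \<in> V" for x y
    using C(2) that by (auto simp: condensation_def)
  have f_p: "f (p x) = f x" if "(c, x) \<in> V" for x
    using p_above[OF that] s(1)[OF rel_Field(2)[OF mono[OF that]]] by simp
  have between: "\<exists>w. (u, w) \<in> V' \<and> (w, v) \<in> V' \<and> w \<noteq> u \<and> w \<noteq> v"
    if uv: "(c, u) \<in> V'" "(u, v) \<in> V'" "u \<noteq> v" for u v
  proof -
    have "(c, v) \<in> V'" using lo_trans[OF C(1)] uv by blast
    then obtain x y where xy: "(c, x) \<in> V" "u = p x" "(c, y) \<in> V" "v = p y"
      using rep uv by meson
    have "(f u, f v) \<in> W" using mono uv by (auto simp: V'_def)
    then have "(f x, f y) \<in> W" using xy f_p by simp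
    moreover have "f x \<noteq> f y" using uv(3) xy p_above by auto
    moreover have "(f c, f x) \<in> W" using mono xy by blast
    ultimately obtain d where d: "(f x, d) \<in> W" "(d, f y) \<in> W" "d \<noteq> f x" "d \<noteq> f y"
      using W(3) unfolding dense_above_def by blast
    have dF: "d \<in> Field W" using rel_Field(1)[OF d(2)] .
    have fcd: "(f c, d) \<in> W" using d \<open>(f c, f x) \<in> W\<close> lo_trans[OF W(1)] by blast
    have csd: "(c, s d) \<in> V" using s_mono[OF fcd] sc by simp
    \<comment> \<open>Since \<open>p\<close> fixes \<open>s d\<close>, the intermediate point found
      in \<open>W\<close> comes back into the carrier of \<open>V'\<close>.\<close>
    have psd: "p (s d) = s d" using p_above[OF csd] s(1)[OF dF] by simp
    have "s d \<in> Field V'" using C(3) psd s(2)[OF dF] by force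
    moreover have "u \<in> Field V'" "v \<in> Field V'" using rel_Field[OF uv(2)] by auto
    moreover have "(u, s d) \<in> V" "(s d, v) \<in> V" using s_mono d xy p_above by auto
    ultimately have "(u, s d) \<in> V'" "(s d, v) \<in> V'" using C(3) by (auto simp: V'_def)
    moreover have "s d \<noteq> u" "s d \<noteq> v" using s(1)[OF dF] d xy f_p by metis+
    ultimately show ?thesis by blast
  qed
  obtain d where d: "(f c, d) \<in> W" "f c \<noteq> d" using W(3) unfolding dense_above_def by blast
  have dF: "d \<in> Field W" using rel_Field(2)[OF d(1)] .
  have csd: "(c, s d) \<in> V" using s_mono[OF d(1)] sc by simp
  have "(c, p (s d)) \<in> V'" using inV'[OF csd] pc by simp
  moreover have "c \<noteq> p (s d)" using f_p[OF csd] s(1)[OF dF] d(2) by metis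
  ultimately have "dense_above V' c" using between unfolding dense_above_def by blast
  then show thesis using that C p_le by blast
qed

text \<open>The chain of covers is built from the top: choose \<open>z\<close> above
  \<open>c\<close>, arrange \<open>m\<close> covers above \<open>z\<close>, then collapse the
  interval from \<open>c\<close> up to but excluding \<open>z\<close> onto \<open>c\<close>, so that
  \<open>z\<close> covers \<open>c\<close>. Points up to \<open>c\<close> stay fixed, which protects
  the buttons, and the dense part above \<open>e\<close> allows the dial to be reset later.\<close>

lemma dense_above_dial:
  assumes "lo V" "dense_above V c"
  shows "\<exists>V' q e. lo V' \<and> condensation V V' q \<and> (\<forall>x. (x, c) \<in> V \<longrightarrow> q x = x) \<and>
     (\<forall>j. covering_chain V' j c \<longleftrightarrow> j \<le> m) \<and> (c, e) \<in> V' \<and> dense_above V' e"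
  using assms(2)
proof (induction m arbitrary: c)
  case 0
  have "\<not> covers V c y" for y
    using 0 lo_refl[OF assms(1) dense_above_Field[OF 0]] unfolding dense_above_def covers_def by metis
  then have "covering_chain V j c \<longleftrightarrow> j \<le> 0" for j by (cases j) auto
  then show ?case using 0 assms(1) condensation_id[of V] lo_refl[OF assms(1) dense_above_Field[OF 0]]
    by (metis id_apply)
next
  case (Suc m)
  note V = assms(1)
  have cF: "c \<in> Field V" using dense_above_Field Suc.prems by fast
  obtain y where y: "(c, y) \<in> V" "c \<noteq> y" using Suc.prems unfolding dense_above_def by blast
  then obtain z where z: "(c, z) \<in> V" "(z, y) \<in> V" "z \<noteq> c" "z \<noteq> y"
    using Suc.prems lo_refl[OF V cF] unfolding dense_above_def by blast
  have "dense_above V z" using dense_above_upward[OF V Suc.prems z(1,2,4)] .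
  from Suc.IH[OF this] obtain V' q e where V': "lo V'" "condensation V V' q"
    and q: "\<And>x. (x, z) \<in> V \<Longrightarrow> q x = x"
    and ch: "\<And>j. covering_chain V' j z \<longleftrightarrow> j \<le> m" and e: "(z, e) \<in> V'" "dense_above V' e"
    by blast
  have mono: "(q x, q y) \<in> V'" if "(x, y) \<in> V" for x y using that V' by (auto simp: condensation_def)
  have qz: "q z = z" using q lo_refl[OF V rel_Field(2)[OF z(1)]] by blast
  have qc: "q c = c" using q z by blast
  have cz: "(c, z) \<in> V'" using mono[OF z(1)] qz qc by simp
  define h where "h x = (if (c, x) \<in> V' \<and> (x, z) \<in> V' \<and> x \<noteq> z then c else x)" for x
  have hc: "h c = c" by (simp add: h_def)
  have hz: "h x = x" if "(z, x) \<in> V'" for x using that lo_antisym[OF V'(1)] by (auto simp: h_def)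
  have h_mono: "(h x, h y) \<in> V'" if xy: "(x, y) \<in> V'" for x y
  proof -
    have F: "x \<in> Field V'" "y \<in> Field V'" "c \<in> Field V'" "z \<in> Field V'"
      using rel_Field[OF xy] rel_Field[OF cz] by auto
    have "(x, c) \<in> V'" if "\<not> ((c, x) \<in> V' \<and> (x, z) \<in> V' \<and> x \<noteq> z)" "(y, z) \<in> V'" "y \<noteq> z"
    proof (rule ccontr)
      assume "(x, c) \<notin> V'"
      then have "(c, x) \<in> V'" using lo_total[OF V'(1)] F by blast
      moreover have "(x, z) \<in> V'" using lo_trans[OF V'(1) xy that(2)] .
      ultimately have "x = z" using that(1) by blast
      then show False using lo_antisym[OF V'(1)] that xy by blast
    qed
    moreover have "(c, y) \<in> V'" if "(c, x) \<in> V'" using lo_trans[OF V'(1) that xy] .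
    ultimately show ?thesis using xy lo_refl[OF V'(1) F(3)] by (simp add: h_def)
  qed
  define V'' where "V'' = Restr V' (h ` Field V')"
  note C = condensation_self_map[of V' h, OF V'(1) h_mono, folded V''_def]
  have ag: "agree_above V' V'' z"
    unfolding V''_def using agree_above_Restr[OF V'(1)] hz by blast
  have cz'': "(c, z) \<in> V''" using C(2) cz hc hz[OF lo_refl[OF V'(1)]] rel_Field(2)[OF cz]
    unfolding condensation_def by metis
  have gap: "u = z" if u: "(c, u) \<in> V''" "(u, z) \<in> V''" "u \<noteq> c" for u
  proof (rule ccontr)
    assume "u \<noteq> z"
    then have "h u = c" using u by (simp add: h_def V''_def)
    moreover obtain x where "u = h x" using rel_Field(2)[OF u(1)] C(3) by auto
    ultimately show False using u \<open>u \<noteq> z\<close> by (auto simp: h_def V''_def split: if_splits)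
  qed
  have cov: "covers V'' c u \<longleftrightarrow> u = z" for u
  proof
    assume u: "covers V'' c u"
    then have cu: "(c, u) \<in> V''" by (simp add: covers_def)
    have "(u, z) \<in> V'' \<or> (z, u) \<in> V''"
      using lo_total[OF C(1) rel_Field(2)[OF cu] rel_Field(2)[OF cz'']] .
    then show "u = z" using u gap[OF cu] cz'' z(3) unfolding covers_def by blast
  next
    show "u = z \<Longrightarrow> covers V'' c u" using gap cz'' z(3) unfolding covers_def by blast
  qed
  have "covering_chain V'' j c \<longleftrightarrow> j \<le> Suc m" for j
    using cov covering_chain_agree[OF ag V'(1)] ch by (cases j) auto
  moreover have "condensation V V'' (h \<circ> q)" using condensation_comp V'(2) C(2) by blast
  moreover have "(h \<circ> q) x = x" if x: "(x, c) \<in> V" for x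
  proof -
    have qx: "q x = x" using q x z lo_trans[OF V] by blast
    moreover have "(x, c) \<in> V'" using mono[OF x] qx qc by simp
    ultimately show ?thesis using lo_antisym[OF V'(1)] by (auto simp: h_def)
  qed
  moreover have "dense_above V'' e"
    using dense_above_agree[OF agree_above_upward[OF V'(1) ag e(1)] e(2) V'(1)] .
  moreover have "(c, e) \<in> V''" using cz'' ag e(1) lo_trans[OF C(1)] unfolding agree_above_def by blast
  ultimately show ?case using C(1) by blast
qed

text \<open>Three condensations in turn: \<open>p\<close> makes the part above \<open>b N\<close>
  dense and fixes every \<open>b j\<close>, then \<open>g\<close> presses button \<open>i\<close> by
  collapsing an interval, and \<open>q\<close> sets the dial. Liveness survives because a dense part
  remains beyond the chain of covers.\<close>

lemma live_move:
  fixes V :: "'a rel" and b :: "nat \<Rightarrow> 'a"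
  assumes V: "lo V" and b: "\<And>j. j < N \<Longrightarrow> (b j, b (Suc j)) \<in> V"
    and live: "live V (b N)" and i: "i < N"
  obtains V' :: "'a rel" and g where "lo V'" "condensation V V' g" "live V' (g (b N))"
    "\<And>j. j < N \<Longrightarrow> g (b j) = g (b (Suc j)) \<longleftrightarrow> j = i \<or> b j = b (Suc j)"
    "\<And>j. covering_chain V' j (g (b N)) \<longleftrightarrow> j \<le> m"
proof -
  let ?c = "b N"
  have bF: "b j \<in> Field V" if "j \<le> N" for j
    using that rel_Field(1)[OF b[of j]] rel_Field(2)[OF b[of "j - 1"]] i by (cases "j < N") auto
  have bm: "(b j, b k) \<in> V" if "j \<le> k" "k \<le> N" for j k
    using that
  proof (induction k rule: dec_induct)
    case base
    then show ?case using bF lo_refl[OF V] by blast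
  next
    case (step k)
    then show ?case using b[of k] lo_trans[OF V] by simp
  qed
  obtain W p where W: "lo W" "condensation V W p" and p: "\<And>x. (x, ?c) \<in> V \<Longrightarrow> p x = x"
    and dW: "dense_above W ?c"
    using live_normalise[OF V bF live] by blast
  have pb: "p (b j) = b j" if "j \<le> N" for j using p bm that by blast
  have bW: "(b j, b k) \<in> W" if "j \<le> k" "k \<le> N" for j k
  proof -
    have "(p (b j), p (b k)) \<in> W" using bm[OF that] W(2) by (auto simp: condensation_def)
    then show ?thesis using pb that by simp
  qed
  \<comment> \<open>The collapse goes to the right endpoint so that everything from
    \<open>b (Suc i)\<close> on is fixed, including \<open>b N\<close> when
    \<open>Suc i = N\<close>.\<close>
  define g where "g x = (if (b i, x) \<in> W \<and> (x, b (Suc i)) \<in> W then b (Suc i) else x)" for x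
  have g_mono: "(g x, g y) \<in> W" if xy: "(x, y) \<in> W" for x y
  proof -
    have F: "x \<in> Field W" "y \<in> Field W" "b i \<in> Field W" "b (Suc i) \<in> Field W"
      using rel_Field[OF xy] rel_Field[OF bW[of i "Suc i"]] i by auto
    have "(b (Suc i), y) \<in> W" if "(b i, x) \<in> W" "\<not> ((b i, y) \<in> W \<and> (y, b (Suc i)) \<in> W)"
      using that lo_trans[OF W(1) that(1) xy] lo_total[OF W(1) F(4,2)] by blast
    moreover have "(x, b (Suc i)) \<in> W" if "(y, b (Suc i)) \<in> W"
      using lo_trans[OF W(1) xy that] .
    ultimately show ?thesis using xy lo_refl[OF W(1) F(4)] by (simp add: g_def)
  qed
  define W' where "W' = Restr W (g ` Field W)"
  note C = condensation_self_map[of W g, OF W(1) g_mono, folded W'_def]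
  have ic: "(b (Suc i), ?c) \<in> W" using bW i by simp
  have g_above: "g x = x" if "(b (Suc i), x) \<in> W" for x
    using that lo_antisym[OF W(1), of x "b (Suc i)"] by (auto simp: g_def)
  have ag: "agree_above W W' ?c" unfolding W'_def
    by (rule agree_above_Restr[OF W(1)]) (use g_above ic lo_trans[OF W(1)] in blast)
  have dW': "dense_above W' ?c" using dense_above_agree[OF ag dW W(1)] .
  obtain V' q e where V': "lo V'" "condensation W' V' q" and q: "\<And>x. (x, ?c) \<in> W' \<Longrightarrow> q x = x"
    and ch: "\<And>j. covering_chain V' j ?c \<longleftrightarrow> j \<le> m" and e: "(?c, e) \<in> V'" "dense_above V' e"
    using dense_above_dial[OF C(1) dW', of m] by blast
  have gc: "g ?c = ?c" using g_above ic by blast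
  have qg: "q (g (b j)) = g (b j)" if "j \<le> N" for j
  proof -
    have "(g (b j), g ?c) \<in> W'" using bW[OF that] C(2) by (auto simp: condensation_def)
    then show ?thesis using q gc by simp
  qed
  let ?h = "q \<circ> g \<circ> p"
  have h: "?h (b j) = g (b j)" if "j \<le> N" for j using that pb qg by simp
  have cond: "condensation V V' ?h" using W(2) C(2) V'(2) by (intro condensation_comp)
  have live': "live V' (?h ?c)" using h[of N] gc live_if_dense_above[OF V'(1) e] by simp
  have dial: "covering_chain V' j (?h ?c) \<longleftrightarrow> j \<le> m" for j using h[of N] gc ch by simp
  have button: "?h (b j) = ?h (b (Suc j)) \<longleftrightarrow> j = i \<or> b j = b (Suc j)" if j: "j < N" for j
  proof -
    \<comment> \<open>Left of \<open>i\<close>, the point \<open>b j\<close> stays put while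
      \<open>b (Suc j)\<close> can only move up, as it does when it equals \<open>b i\<close>. Right
      of \<open>i\<close>, both are fixed.\<close>
    have "g (b j) \<noteq> g (b (Suc j))" if n: "j \<noteq> i" "b j \<noteq> b (Suc j)"
    proof (cases "j < i")
      case True
      have 1: "(b j, b (Suc j)) \<in> W" "(b (Suc j), b i) \<in> W" "(b (Suc j), b (Suc i)) \<in> W"
        using bW True i by simp_all
      have "(b i, b j) \<notin> W" using 1 n lo_trans[OF W(1)] lo_antisym[OF W(1)] by blast
      then have "g (b j) = b j" by (simp add: g_def)
      moreover have "(b (Suc j), g (b (Suc j))) \<in> W"
        using 1 bW[of "Suc j" "Suc j"] j by (simp add: g_def)
      ultimately show ?thesis using 1 n lo_antisym[OF W(1)] by metis
    next
      case False
      then have 1: "(b j, b (Suc j)) \<in> W" "(b (Suc i), b j) \<in> W" using bW n(1) j by simp_all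
      then have "g (b (Suc j)) = b (Suc j)" "g (b j) = b j"
        using g_above lo_trans[OF W(1)] by blast+
      then show ?thesis using n by simp
    qed
    moreover have "g (b i) = g (b (Suc i))" using bW[of i "Suc i"] bW[of i i] bW[of "Suc i" "Suc i"] i
      by (simp add: g_def)
    ultimately show ?thesis using h j by (metis Suc_leI less_imp_le)
  qed
  show thesis by (rule that[of V' ?h]) (fact V'(1) cond live' button dial)+
qed

subsection \<open>Non-scattered orders\<close>

text \<open>Each point is replaced by the cut of rationals from \<open>s\<close> on that it
  determines in the copy of the rationals. Points with equal cuts are identified, and between two
  different cuts lies the cut of some rational.\<close>

lemma live_non_scattered:
  fixes e :: "rat \<Rightarrow> 'a"
  assumes L: "lo L" and e: "\<And>x y. (e x, e y) \<in> L \<longleftrightarrow> x \<le> y"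
  shows "live L (e s)"
proof -
  have eF: "e q \<in> Field L" for q using rel_Field(1)[of "e q" "e q" L] e by simp
  \<comment> \<open>The strict inequality leaves the cuts without a greatest element. Thus a
    rational \<open>q\<close> separating two cuts leaves room for \<open>m\<close> between
    \<open>q\<close> and \<open>q'\<close>, whose own cut lies strictly between them.\<close>
  define K where "K x = {q. s \<le> q \<and> (\<exists>q'>q. (e q', x) \<in> L)}" for x
  have K_mono: "K x \<subseteq> K y" if "(x, y) \<in> L" for x y
    using lo_trans[OF L _ that] by (auto simp: K_def)
  have K_e: "K (e q) = {p. s \<le> p \<and> p < q}" for q
    by (auto simp: K_def e)
  \<comment> \<open>One representative is chosen in each fibre of \<open>K\<close>, so the quotient
    lives inside \<open>L\<close>.\<close>
  define g where "g x = inv_into (Field L) K (K x)" for x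
  have g: "K (g x) = K x" "g x \<in> Field L" if "x \<in> Field L" for x
    using that by (auto simp: g_def f_inv_into_f inv_into_into)
  have g_le: "(g x, g y) \<in> L" if xy: "x \<in> Field L" "y \<in> Field L" "K x \<subseteq> K y" for x y
  proof (cases "(g y, g x) \<in> L")
    case True
    then have "K x = K y" using K_mono[OF True] g xy by simp
    then have "g x = g y" by (simp add: g_def)
    then show ?thesis using g xy lo_refl[OF L] by simp
  next
    case False
    then show ?thesis using lo_total[OF L] g xy by blast
  qed
  have g_mono: "(g x, g y) \<in> L" if "(x, y) \<in> L" for x y
    using g_le K_mono[OF that] rel_Field[OF that] by blast
  define V where "V = Restr L (g ` Field L)"
  note C = condensation_self_map[of L g, OF L g_mono, folded V_def]
  have g_le_V: "(g x, g y) \<in> V" if "x \<in> Field L" "y \<in> Field L" "K x \<subseteq> K y" for x y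
    using g_le[OF that] that by (auto simp: V_def)
  have "\<exists>z. (u, z) \<in> V \<and> (z, v) \<in> V \<and> z \<noteq> u \<and> z \<noteq> v" if uv: "(u, v) \<in> V" "u \<noteq> v" for u v
  proof -
    obtain x y where xy: "x \<in> Field L" "u = g x" "y \<in> Field L" "v = g y"
      using uv by (auto simp: V_def)
    have "K (g x) \<subseteq> K (g y)" using K_mono uv xy by (auto simp: V_def)
    then have "K x \<subseteq> K y" using g xy by simp
    moreover have "K x \<noteq> K y" using uv xy by (auto simp: g_def)
    ultimately obtain q where q: "q \<in> K y" "q \<notin> K x" by blast
    then obtain q' where q': "s \<le> q" "q < q'" "(e q', y) \<in> L" by (auto simp: K_def)
    have below: "p \<le> q" if "(e p, x) \<in> L" for p
      using q(2) q'(1) that by (force simp: K_def)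
    obtain m where m: "q < m" "m < q'" using dense[OF q'(2)] by blast
    have "K x \<subseteq> K (e m)" using below m by (force simp: K_def[of x] K_e)
    moreover have "K (e m) \<subseteq> K y"
      using K_mono lo_trans[OF L _ q'(3), of "e m"] e m by simp
    ultimately have "(u, g (e m)) \<in> V" "(g (e m), v) \<in> V" using g_le_V xy eF by auto
    moreover have "q \<in> K (e m)" "m \<in> K y" "m \<notin> K (e m)"
      using q' m by (auto simp: K_e) (auto simp: K_def)
    then have "K (e m) \<noteq> K x" "K (e m) \<noteq> K y" using q by auto
    then have "g (e m) \<noteq> u" "g (e m) \<noteq> v" using g(1)[OF eF] g(1) xy by metis+
    ultimately show ?thesis by blast
  qed
  moreover have "(g (e s), g (e (s + 1))) \<in> V" by (rule g_le_V) (auto simp: eF K_e)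
  moreover have "g (e s) \<noteq> g (e (s + 1))"
  proof
    assume "g (e s) = g (e (s + 1))"
    then have "K (e s) = K (e (s + 1))" using g(1)[OF eF] by metis
    then have "s \<in> K (e s)" by (simp add: K_e)
    then show False by (simp add: K_e)
  qed
  ultimately have "dense_above V (g (e s))" unfolding dense_above_def by blast
  then show ?thesis unfolding live_def using C by blast
qed

lemma non_scattered_exists:
  assumes "infinite (UNIV :: 'a set)"
  obtains L :: "'a rel" where "lo L" "\<not> scattered L"
proof -
  obtain k :: "nat \<Rightarrow> 'a" where k: "inj k" using infinite_countable_subset[OF assms] by blast
  define e :: "rat \<Rightarrow> 'a" where "e = k \<circ> to_nat"
  have e: "inj e" unfolding e_def using k by (intro inj_compose) auto
  define Q :: "rat rel" where "Q = {(x, y). x \<le> y}"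
  have FQ: "Field Q = UNIV" by (auto simp: Q_def Field_def)
  have "lo Q" unfolding lo_def order_on_defs FQ
    by (auto simp: Q_def refl_on_def trans_def antisym_def total_on_def)
  note T = lo_transfer[OF this, of e, unfolded FQ, OF e]
  have "x \<le> y \<longleftrightarrow> (e x, e y) \<in> (\<lambda>(x, y). (e x, e y)) ` Q" for x y
    by (auto simp: Q_def image_iff inj_eq[OF e])
  then show thesis using that T(1) unfolding scattered_def by blast
qed

section \<open>Transfer of a finite countermodel to a non-scattered order\<close>

lemma countermodel_not_valid:
  fixes L :: "'a rel"
  assumes L: "lo L" and ns: "\<not> scattered L"
    and frame: "topped_frame F R r t" and fails: "\<not> force F R v r \<psi>"
  shows "\<psi> \<notin> Val L (lang L)"
proof -
  interpret topped_frame F R r t by (fact frame)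
  obtain e :: "rat \<Rightarrow> 'a" where e: "\<And>x y. (e x, e y) \<in> L \<longleftrightarrow> x \<le> y"
    using ns unfolding scattered_def by metis
  have e_inj: "e x = e y \<longleftrightarrow> x = y" for x y using e by (metis order.antisym order.refl)
  define N where "N = card F"
  obtain h where h: "bij_betw h {0..<N} F"
    using ex_bij_betw_nat_finite[OF finite_F] unfolding N_def by blast
  have hF: "h i \<in> F" if "i < N" for i using h that by (auto dest: bij_betwE)
  have h_surj: "\<exists>i<N. h i = w" if "w \<in> F" for w using h that by (force simp: bij_betw_def)
  define a where "a i = e (of_nat i)" for i
  have a_step: "(a j, a (Suc j)) \<in> L" "a j \<noteq> a (Suc j)" for j
    by (auto simp: a_def e e_inj)
  have aF: "a j \<in> Field L" for j using rel_Field(1)[OF a_step(1)] .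
  define btns where "btns f = {h i | i. i < N \<and> f (a i) = f (a (Suc i))}" for f :: "'a \<Rightarrow> 'a"
  \<comment> \<open>Counting stops at \<open>N\<close>: there are \<open>N + 1\<close> positions,
    even above an endless sequence of covers, and the position is a Boolean function of
    \<open>N\<close> sentences. The count uses \<open>Suc j\<close> because length 0 is always
    attained.\<close>
  define dial where "dial V f = card {j. j < N \<and> covering_chain V (Suc j) (f (a N))}"
    for V :: "'a rel" and f
  \<comment> \<open>The position of the dial at \<open>L\<close> itself is not under control, so it
    is made to read \<open>r\<close>. The remaining \<open>N\<close> positions enumerate
    \<open>F\<close>, skipping that one.\<close>
  define d where "d m = (if m = dial L id then r else if m < dial L id then h m else h (m - 1))" for m
  define lab where "lab V f = label (live V (f (a N))) (btns f) (d (dial V f))"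
    for V :: "'a rel" and f
  have d_surj: "\<exists>m\<le>N. d m = w" if w: "w \<in> F" for w
  proof -
    obtain i where i: "i < N" "h i = w" using h_surj[OF w] by blast
    show ?thesis
    proof (cases "i < dial L id")
      case True
      then show ?thesis using i by (intro exI[of _ i]) (simp add: d_def)
    next
      case False
      then show ?thesis using i by (intro exI[of _ "Suc i"]) (simp add: d_def)
    qed
  qed
  have btnsF: "btns f \<subseteq> F" for f using hF by (auto simp: btns_def)
  have lab_L: "lab L id = r"
  proof -
    have "btns id = {}" using a_step by (simp add: btns_def)
    moreover have "live L (a N)" unfolding a_def using live_non_scattered[OF L e] .
    ultimately show ?thesis using label_root by (simp add: lab_def d_def)
  qed
  have lab_F: "lab V f \<in> F" for V f using label_in[OF btnsF] by (simp add: lab_def)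
  have lab_forth: "R (lab V f) (lab V' (g \<circ> f))" if "condensation V V' g" for V V' f g
    unfolding lab_def
  proof (rule label_mono)
    show "btns f \<subseteq> btns (g \<circ> f)" by (auto simp: btns_def)
    show "live V (f (a N))" if "live V' ((g \<circ> f) (a N))"
      using live_upstream[OF \<open>condensation V V' g\<close>] that by simp
  qed (rule btnsF)
  \<comment> \<open>A live label is moved by pressing the button of \<open>w\<close> and turning the
    dial to a position reading \<open>w\<close>. A dead label is \<open>t\<close>, so
    \<open>w\<close> is \<open>t\<close> too and the identity suffices.\<close>
  have lab_back: "\<exists>V' g. lo V' \<and> condensation V V' g \<and> lab V' (g \<circ> f) = w"
    if V: "lo V" "condensation L V f" and w: "w \<in> F" "R (lab V f) w" for V f w
  proof (cases "live V (f (a N)) \<and> chain (insert r (btns f))")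
    case True
    obtain i where i: "i < N" "h i = w" using h_surj[OF w(1)] by blast
    obtain m where m: "m \<le> N" "d m = w" using d_surj[OF w(1)] by blast
    have b: "(f (a j), f (a (Suc j))) \<in> V" for j
      using V(2) a_step by (auto simp: condensation_def)
    have lv: "live V (f (a N))" using True ..
    obtain V' :: "'a rel" and g where V': "lo V'" "condensation V V' g" "live V' (g (f (a N)))"
      and but: "\<And>j. j < N \<Longrightarrow> g (f (a j)) = g (f (a (Suc j))) \<longleftrightarrow> j = i \<or> f (a j) = f (a (Suc j))"
      and chn: "\<And>j. covering_chain V' j (g (f (a N))) \<longleftrightarrow> j \<le> m"
      by (rule live_move[of V N "\<lambda>j. f (a j)" i m, OF V(1) b lv i(1)]) blast
    have "btns (g \<circ> f) = insert w (btns f)" using i but by (auto simp: btns_def)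
    moreover have "{j. j < N \<and> Suc j \<le> m} = {..<m}" using m by auto
    then have "dial V' (g \<circ> f) = m" by (simp add: dial_def chn del: covering_chain.simps)
    moreover have "label True (insert w (btns f)) w = w"
      using label_step[OF btnsF] True w unfolding lab_def by blast
    ultimately have "lab V' (g \<circ> f) = w" using V'(3) m by (simp add: lab_def)
    then show ?thesis using V' by blast
  next
    case False
    then have "lab V f = t" using label_dead unfolding lab_def by blast
    then have "lab V (id \<circ> f) = w" using w final_max[of w] by simp
    then show ?thesis using V(1) condensation_id by blast
  qed
  \<comment> \<open>In order: \<open>N\<close> sentences for the buttons, \<open>N\<close> for the
    dial and one for liveness. \<open>Q\<close> decodes their truth pattern into the label and
    evaluates \<open>p\<close> there.\<close>
  define \<chi> where "\<chi> i = (if i < N then Eq (Const (a i)) (Const (a (Suc i)))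
     else if i < 2 * N then covering_chain_fm (Suc (i - N)) (Const (a N)) 0
     else Dia (dense_above_fm (a N)))" for i
  define Q where "Q p S = v p (label (2 * N \<in> S) {h i | i. i < N \<and> i \<in> S}
     (d (card {j. j < N \<and> N + j \<in> S})))" for p S
  have "fv (\<chi> i) = {} \<and> set_fm (\<chi> i) \<subseteq> Field L" for i
    using aF covering_chain_fm_lang[of "Suc (i - N)" "Const (a N)" 0]
    by (auto simp: \<chi>_def dense_above_fm_def)
  then have "\<exists>\<theta>. fv \<theta> = {} \<and> set_fm \<theta> \<subseteq> Field L \<and> (\<forall>(U :: 'a rel) \<iota> \<nu>.
      sat U \<iota> \<nu> \<theta> \<longleftrightarrow> Q p {i. i < 2 * N + 1 \<and> sat U \<iota> \<nu> (\<chi> i)})" for p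
    by (intro boolean_combination) blast
  then obtain \<sigma> where \<sigma>: "\<And>p. fv (\<sigma> p) = {} \<and> set_fm (\<sigma> p) \<subseteq> Field L"
    and sat_\<sigma>: "\<And>p (U :: 'a rel) \<iota> \<nu>.
      sat U \<iota> \<nu> (\<sigma> p) \<longleftrightarrow> Q p {i. i < 2 * N + 1 \<and> sat U \<iota> \<nu> (\<chi> i)}"
    by metis
  have Q_lab: "Q p {i. i < 2 * N + 1 \<and> sat V f \<nu> (\<chi> i)} \<longleftrightarrow> v p (lab V f)" for p V f \<nu>
  proof -
    let ?S = "{i. i < 2 * N + 1 \<and> sat V f \<nu> (\<chi> i)}"
    have "{h i | i. i < N \<and> i \<in> ?S} = btns f" by (auto simp: btns_def \<chi>_def)
    moreover have "{j. j < N \<and> N + j \<in> ?S} = {j. j < N \<and> covering_chain V (Suc j) (f (a N))}"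
      by (auto simp: \<chi>_def sat_covering_chain_fm simp del: covering_chain_fm.simps covering_chain.simps)
    moreover have "2 * N \<in> ?S \<longleftrightarrow> live V (f (a N))"
      using sat_live_fm[of V f \<nu> "a N"] by (simp add: \<chi>_def del: sat.simps)
    ultimately show ?thesis unfolding Q_def lab_def dial_def by simp
  qed
  \<comment> \<open>Elements of \<open>L\<close> are their own names, so at the world reached by
    \<open>f\<close> the constants are interpreted by \<open>f\<close> itself.\<close>
  have truth: "sat V f \<nu> (inst \<sigma> \<phi>) \<longleftrightarrow> force F R v (lab V f) \<phi>"
    if "lo V" "condensation L V f" for V f \<nu> \<phi>
    using that
  proof (induction \<phi> arbitrary: V f \<nu>)
    case (PVar p)
    then show ?case by (simp only: inst.simps force.simps sat_\<sigma> Q_lab)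
  next
    case (PBox \<phi>)
    have IH: "sat V' (g \<circ> f) (g \<circ> \<nu>) (inst \<sigma> \<phi>) \<longleftrightarrow> force F R v (lab V' (g \<circ> f)) \<phi>"
      if "lo V'" "condensation V V' g" for V' g
      using PBox.IH that condensation_comp[OF PBox.prems(2)] by blast
    show ?case
    proof
      assume *: "sat V f \<nu> (inst \<sigma> (\<box>\<^sub>p \<phi>))"
      have "force F R v w \<phi>" if w: "w \<in> F" "R (lab V f) w" for w
      proof -
        obtain V' g where "lo V'" "condensation V V' g" "lab V' (g \<circ> f) = w"
          using lab_back[OF PBox.prems w] by blast
        then show ?thesis using IH[of V' g] * by simp
      qed
      then show "force F R v (lab V f) (\<box>\<^sub>p \<phi>)" by simp
    next
      assume *: "force F R v (lab V f) (\<box>\<^sub>p \<phi>)"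
      have "sat V' (g \<circ> f) (g \<circ> \<nu>) (inst \<sigma> \<phi>)" if "lo V'" "condensation V V' g"
        for V' :: "'a rel" and g
        using IH[OF that] lab_forth[OF that(2)] * lab_F by simp
      then show "sat V f \<nu> (inst \<sigma> (\<box>\<^sub>p \<phi>))" by simp
    qed
  qed auto
  have "\<not> sat L id \<nu> (inst \<sigma> \<psi>)" for \<nu>
    using truth[OF L condensation_id] fails lab_L by simp
  \<comment> \<open>Refuting \<open>holds\<close> takes an assignment with values in
    \<open>L\<close>; a constant one will do.\<close>
  moreover have "range (\<lambda>_::nat. a 0) \<subseteq> Field L" using aF by auto
  ultimately have "\<not> holds L (inst \<sigma> \<psi>)" unfolding holds_def by blast
  moreover have "range \<sigma> \<subseteq> lang L" using \<sigma> by (auto simp: lang_def)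
  ultimately show ?thesis unfolding Val_def by blast
qed

section \<open>Validities at non-scattered orders and at all worlds\<close>

theorem Val_non_scattered:
  assumes "lo L" "\<not> scattered L"
  shows "Val L (lang L) = S421"
proof
  show "Val L (lang L) \<subseteq> S421"
    using S421_complete countermodel_not_valid[OF assms] by (metis subsetI)
qed (rule S421_subset_Val[OF assms(1)])

text \<open>Soundness at every world gives one inclusion of the last equality; a single
  non-scattered world gives the other. Infinity of the type ensures that it has room for a copy of
  the rationals and hence for such a world.\<close>

theorem theorem8p4:
  fixes L :: "'a rel"
  shows "(lo L \<and> \<not> scattered L \<longrightarrow> Val L (lang L) = S421) \<and>
         (\<forall>W :: 'a rel. lo W \<longrightarrow> S421 \<subseteq> Val W (lang W)) \<and>
         (infinite (UNIV :: 'a set) \<longrightarrow>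
            {\<psi>. \<forall>W :: 'a rel. lo W \<longrightarrow> \<psi> \<in> Val W (lang W)} = S421)"
proof (intro conjI impI allI)
  assume "infinite (UNIV :: 'a set)"
  then obtain M :: "'a rel" where "lo M" "Val M (lang M) = S421"
    using non_scattered_exists Val_non_scattered by metis
  then show "{\<psi>. \<forall>W :: 'a rel. lo W \<longrightarrow> \<psi> \<in> Val W (lang W)} = S421"
    using S421_subset_Val by blast
qed (auto simp: Val_non_scattered S421_subset_Val)

end
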